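(* Let $\kappa$ be a probability distribution on the positive integers such that $\kappa(\{k\})>0$ for every $k\in\mathbb{N}$, and such that for some $\beta>0$, $\kappa(\{k\in\mathbb{N}: k\ge j\})\le \exp(-\beta j\log j)$ for all sufficiently large $j$. Let $\pi$ be the prior on $\widetilde{\mathcal F}$ built from $\kappa$ (defined in the context). Let $f_0:[0,1]\to[0,1]$ be an arbitrary measurable function, and let $Z_1,Z_2,\dots$ be drawn i.i.d. from the distribution $F_0$ on $[0,1]\times\{0,1\}$ which has density $\widetilde f_0$ with respect to $\nu$; equivalently, $Z_i=(X_i,Y_i)$ where the $X_i$ are independent and uniform on $[0,1]$ and, conditionally on $X_i=x_i$, $Y_i$ is an independent Bernoulli$(f_0(x_i))$ random variable. Then for any $\epsilon>0$, $$\pi(H_\epsilon\mid Z_1,\dots,Z_n)\to 1\quad\text{as } n\to\infty,\qquad F_0^\infty\text{-almost surely}.$$ Specifically, for any $1\le p<\infty$ and any $\epsilon>0$, the posterior mass $\pi(\{\widetilde f\in\widetilde{\mathcal F}: \|f-f_0\|_p<\epsilon\}\mid Z_1,\dots,Z_n)$ tends to $1$ as $n\to\infty$, $F_0^\infty$-almost surely.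
   Context: Let $\mathcal F$ be the class of all Borel measurable functions $f:[0,1]\to[0,1]$. Let $\mu$ be the uniform distribution on $[0,1]$, $\eta$ counting measure on $\{0,1\}$, and $\nu=\mu\times\eta$ on $\mathcal Z=[0,1]\times\{0,1\}$. For $f\in\mathcal F$ let $\widetilde f(x,y)=f(x)\mathbf 1\{y=1\}+(1-f(x))\mathbf 1\{y=0\}$, a probability density with respect to $\nu$, and let $\widetilde{\mathcal F}=\{\widetilde f: f\in\mathcal F\}$, with the Borel $\sigma$-field induced by the Hellinger metric $d(\widetilde f,\widetilde g)=\{\int(\widetilde f(z)^{1/2}-\widetilde g(z)^{1/2})^2\,\nu(dz)\}^{1/2}$. For $\epsilon>0$, $H_\epsilon=\{\widetilde f\in\widetilde{\mathcal F}: d(\widetilde f_0,\widetilde f)\le\epsilon\}$. $\|\cdot\|_p$ is the $L^p$ norm on $[0,1]$ with Lebesgue measure. Prior. For $k\ge1$ let $\Theta_k=\{(k,\mathbf v,\mathbf s):\mathbf v\in[0,1]^{k-1},\mathbf s\in[0,1]^k\}$ and $\Theta=\bigcup_{k\ge1}\Theta_k$ (for $k=1$ there is no $\mathbf v$-component). Let $\mathbf v_{(i)}$ be the $i$-th ordered (increasing) value of $\mathbf v$. For $\theta=(k,\mathbf v,\mathbf s)$ with $k>1$ put $I_1=[0,\mathbf v_{(1)})$, $I_i=[\mathbf v_{(i-1)},\mathbf v_{(i)})$ for $2\le i\le k-1$, $I_k=[\mathbf v_{(k-1)},1]$; for $k=1$ put $I_1=[0,1]$. Let $f_\theta(x)=\sum_{i=1}^k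 \mathbf s_i\mathbf 1\{x\in I_i\}$. To draw $\widetilde f$ from $\pi$: draw $K\sim\kappa$; given $K=k$ draw $\mathbf v$ and $\mathbf s$ independently and uniformly from $[0,1]^{k-1}$ and $[0,1]^k$; set $\theta=(k,\mathbf v,\mathbf s)$ and $\widetilde f=\widetilde{f_\theta}$. The posterior is given by Bayes' theorem: for measurable $B\subset\widetilde{\mathcal F}$, $\pi(B\mid z_1,\dots,z_n)=\int_B\prod_{i=1}^n\widetilde f(z_i)\,\pi(d\widetilde f)\big/\int_{\widetilde{\mathcal F}}\prod_{i=1}^n\widetilde f(z_i)\,\pi(d\widetilde f)$. *)

theory Defs
  imports "HOL-Probability.Probability"
begin

text \<open>
  Functions on a subset of a type are represented by extensional functions, so that
  \<open>unit_funs\<close> and \<open>densities\<close> are in bijection with the sets of all Borel measurable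
  functions on the unit interval with values in the unit interval and of all
  densities obtained from them.
\<close>

definition unit_uniform :: "real measure" where
  "unit_uniform = restrict_space lborel {0..1}"

definition base_measure :: "(real \<times> nat) measure" where
  "base_measure = unit_uniform \<Otimes>\<^sub>M count_space {0, 1}"

definition unit_funs :: "(real \<Rightarrow> real) set" where
  "unit_funs = {f \<in> {0..1} \<rightarrow>\<^sub>E {0..1}. f \<in> borel_measurable (restrict_space borel {0..1})}"

definition dens :: "(real \<Rightarrow> real) \<Rightarrow> real \<times> nat \<Rightarrow> real" where
  "dens f = restrict (\<lambda>(x, y). f x * of_bool (y = 1) + (1 - f x) * of_bool (y = 0))
     ({0..1} \<times> {0, 1})"

definition densities :: "(real \<times> nat \<Rightarrow> real) set" where
  "densities = dens ` unit_funs"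

definition hellinger :: "(real \<times> nat \<Rightarrow> real) \<Rightarrow> (real \<times> nat \<Rightarrow> real) \<Rightarrow> real" where
  "hellinger f g = sqrt (\<integral>z. (sqrt (f z) - sqrt (g z))\<^sup>2 \<partial>base_measure)"

text \<open>
  On \<open>densities\<close>, \<open>hellinger\<close> is only a pseudometric: it vanishes on pairs of
  functions that agree almost everywhere.  The Borel sigma-algebra below is the one generated
  by its open sets.
\<close>

definition hellinger_borel :: "(real \<times> nat \<Rightarrow> real) measure" where
  "hellinger_borel = sigma densities
     {U. U \<subseteq> densities \<and> (\<forall>f\<in>U. \<exists>e>0. \<forall>g\<in>densities. hellinger f g < e \<longrightarrow> g \<in> U)}"

text \<open>
  Every set in \<open>hellinger_borel\<close> is closed under changing a density on a null set, so the
  point evaluations \<open>f \<mapsto> f z\<close>, and with them the likelihood in Bayes' formula, are not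
  measurable with respect to it.  The prior is therefore carried by the sigma-algebra obtained
  by adjoining all point evaluations; its restriction to \<open>hellinger_borel\<close> is the law of the
  random density on the Hellinger Borel sets.
\<close>

definition density_algebra :: "(real \<times> nat \<Rightarrow> real) measure" where
  "density_algebra = sigma densities
     (sets hellinger_borel \<union>
      {{f \<in> densities. f z \<in> A} | z A. z \<in> space base_measure \<and> A \<in> sets borel})"

definition ordered_value :: "nat \<Rightarrow> (nat \<Rightarrow> real) \<Rightarrow> nat \<Rightarrow> real" where
  "ordered_value k v i = sort (map v [1..<k]) ! (i - 1)"

definition piece :: "nat \<Rightarrow> (nat \<Rightarrow> real) \<Rightarrow> nat \<Rightarrow> real set" where
  "piece k v i =
     (if k = 1 then {0..1}
      else if i = 1 then {0..<ordered_value k v 1}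
      else if i = k then {ordered_value k v (k - 1)..1}
      else {ordered_value k v (i - 1)..<ordered_value k v i})"

definition step_fun :: "nat \<times> (nat \<Rightarrow> real) \<times> (nat \<Rightarrow> real) \<Rightarrow> real \<Rightarrow> real" where
  "step_fun = (\<lambda>(k, v, s). restrict (\<lambda>x. \<Sum>i=1..k. s i * indicator (piece k v i) x) {0..1})"

text \<open>
  The number of pieces is drawn from \<open>\<kappa>\<close>, whose mass at \<open>0\<close> is assumed to vanish wherever
  the prior is used.  The split points are indexed by \<open>{1..<k}\<close> and the values by \<open>{1..k}\<close>.
\<close>

definition prior :: "nat pmf \<Rightarrow> (real \<times> nat \<Rightarrow> real) measure" where
  "prior \<kappa> = measure_pmf \<kappa> \<bind> (\<lambda>k.
     distr ((\<Pi>\<^sub>M i\<in>{1..<k}. unit_uniform) \<Otimes>\<^sub>M (\<Pi>\<^sub>M i\<in>{1..k}. unit_uniform))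
       density_algebra (\<lambda>(v, s). dens (step_fun (k, v, s))))"

text \<open>The observations are \<open>z 0, \<dots>, z (n - 1)\<close>.\<close>

definition posterior ::
  "nat pmf \<Rightarrow> nat \<Rightarrow> (nat \<Rightarrow> real \<times> nat) \<Rightarrow> (real \<times> nat \<Rightarrow> real) set \<Rightarrow> real" where
  "posterior \<kappa> n z B =
     (LINT f:B|prior \<kappa>. (\<Prod>i<n. f (z i))) / (LINT f|prior \<kappa>. (\<Prod>i<n. f (z i)))"

definition data_dist :: "(real \<Rightarrow> real) \<Rightarrow> (real \<times> nat) measure" where
  "data_dist f0 = density base_measure (\<lambda>z. ennreal (dens f0 z))"

definition hellinger_nbhd :: "(real \<Rightarrow> real) \<Rightarrow> real \<Rightarrow> (real \<times> nat \<Rightarrow> real) set" where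
  "hellinger_nbhd f0 \<epsilon> = {f \<in> densities. hellinger (dens f0) f \<le> \<epsilon>}"

definition lp_norm :: "real \<Rightarrow> (real \<Rightarrow> real) \<Rightarrow> real" where
  "lp_norm p f = (\<integral>x. \<bar>f x\<bar> powr p \<partial>unit_uniform) powr (1 / p)"

end

theory Submission
  imports Defs
begin

text \<open>
  Write \<open>d\<close> for the density \<open>dens f0\<close> of the observations, \<open>z\<close> for the data, and let \<open>\<epsilon> > 0\<close>.
  The posterior mass at Hellinger distance more than \<open>\<epsilon>\<close> from \<open>d\<close> is the quotient of
  \<open>N = \<integral> \<Prod> f(z i) / d(z i)\<close> over the far densities \<open>f\<close> and of the same integral \<open>M\<close> over all
  densities.  It tends to \<open>0\<close> because, almost surely, \<open>N\<close> is eventually exponentially small while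
  \<open>M\<close> is eventually larger than any given exponential \<open>q powr - n\<close> with \<open>q > 1\<close>, up to a constant
  factor.  In both cases the random integral is compared with products over the observations of one
  fixed function.  The expectation of such a product is the \<open>n\<close>-th power of a single integral, and
  Markov's inequality with the Borel-Cantelli lemma turns a bound on expectations into an almost
  sure bound (\<open>AE_eventually_le_geometric\<close>).

  For \<open>N\<close> (\<open>numerator_bound\<close>), cut the unit interval into a fixed multiple of \<open>k\<close> equal cells.
  A step function with \<open>k\<close> pieces is constant on all but at most \<open>k - 1\<close> of them.  Rounding its values up
  on the good cells and using the bound \<open>1\<close> on the others gives a majorant of its density that
  exceeds it by a small integral, and at most \<open>C ^ k\<close> majorants occur.  If the density is far from
  \<open>d\<close>, then the affinity \<open>\<integral> sqrt (u * d)\<close> of the majorant \<open>u\<close> with \<open>d\<close> is at most some \<open>\<rho> < 1\<close>, and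
  this affinity is the expectation of \<open>sqrt (u / d)\<close> under one observation.  Since the root
  of a sum is at most the sum of the roots, \<open>sqrt N\<close> is at most the sum over \<open>k\<close> and \<open>u\<close> of
  \<open>sqrt \<kappa>(k) * \<Prod> sqrt (u(z i) / d(z i))\<close>, which has expectation at most \<open>\<rho> ^ n\<close> times the
  series \<open>\<Sum>k. sqrt \<kappa>(k) * C ^ k\<close>.  The tail condition on \<open>\<kappa>\<close> makes this series converge.

  For \<open>M\<close> (\<open>denominator_bound\<close>), approximate \<open>f0\<close> in the mean by a continuous function and move
  that function slightly towards \<open>1/2\<close>.  For some \<open>k\<close> the parameters of the step functions with \<open>k\<close>
  pieces that are uniformly close to the result have positive probability.  Their densities all lie
  above one function \<open>l\<close>, bounded away from \<open>0\<close>, with \<open>\<integral> d ^ 2 / l\<close> as close to \<open>1\<close> as desired.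
  As \<open>\<kappa>(k) > 0\<close>, \<open>M\<close> is at least a positive constant times \<open>\<Prod> l(z i) / d(z i)\<close>, and the inverse of the
  last product has expectation \<open>(\<integral> d ^ 2 / l) ^ n\<close>.

  For the second claim, every ball in an \<open>L\<^sup>p\<close> norm contains a Hellinger ball
  (\<open>hellinger_nbhd_subset_lp_ball\<close>).  All this presupposes that the sets involved and the map from
  parameters to densities are measurable; the latter holds because that map is continuous for the
  Hellinger distance (\<open>hellinger_step_tendsto\<close>).
\<close>

section \<open>The base measure and the densities\<close>

(* Measurability is derived from explicit introduction rules throughout, so the simplifier
   is only given the trivial cases. *)
declare [[simproc del: measurable]]
declare borel_measurable_const [simp] borel_closed [simp] borel_open [simp]

lemma space_unit_uniform [simp]: "space unit_uniform = {0..1}"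
  by (simp add: unit_uniform_def space_restrict_space)

lemma sets_unit_uniform: "sets unit_uniform = sets (restrict_space borel {0..1})"
  by (simp add: unit_uniform_def sets_restrict_space)

lemma prob_space_unit_uniform: "prob_space unit_uniform"
  by (rule prob_spaceI) (simp add: unit_uniform_def emeasure_restrict_space space_restrict_space)

text \<open>
  The Borel sets of the unit interval arise from \<open>borel\<close> and from \<open>lborel\<close> alike; \<open>unit_funs\<close>
  uses the former, \<open>unit_uniform\<close> the latter.
\<close>

lemma measurable_unit_uniform_cong:
  "measurable unit_uniform N = measurable (restrict_space borel {0..1}) N"
  by (rule measurable_cong_sets) (simp_all add: sets_unit_uniform)

lemma borel_imp_unit_measurable:
  "f \<in> measurable borel N \<Longrightarrow> f \<in> measurable unit_uniform N"
  unfolding measurable_unit_uniform_cong by (rule measurable_restrict_space1)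

lemma space_base_measure [simp]: "space base_measure = {0..1} \<times> {0, 1}"
  by (simp add: base_measure_def space_pair_measure)

lemma sigma_finite_labels: "sigma_finite_measure (count_space {0, 1 :: nat})"
  by (rule sigma_finite_measure_count_space_finite) simp

lemma pair_sigma_finite_base: "pair_sigma_finite unit_uniform (count_space {0, 1 :: nat})"
  by (intro pair_sigma_finite.intro sigma_finite_labels
        prob_space_imp_sigma_finite prob_space_unit_uniform)

lemma nn_integral_base_measure:
  assumes "g \<in> borel_measurable base_measure"
  shows "(\<integral>\<^sup>+z. g z \<partial>base_measure) = (\<integral>\<^sup>+x. g (x, 0) + g (x, 1) \<partial>unit_uniform)"
proof -
  interpret sigma_finite_measure "count_space {0, 1 :: nat}" by (rule sigma_finite_labels)
  have "g \<in> borel_measurable (unit_uniform \<Otimes>\<^sub>M count_space {0, 1})"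
    using assms by (simp add: base_measure_def)
  have "(\<integral>\<^sup>+z. g z \<partial>base_measure) = (\<integral>\<^sup>+x. \<integral>\<^sup>+y. g (x, y) \<partial>count_space {0, 1} \<partial>unit_uniform)"
    unfolding base_measure_def by (rule nn_integral_fst[symmetric]) fact
  also have "\<dots> = (\<integral>\<^sup>+x. g (x, 0) + g (x, 1) \<partial>unit_uniform)"
    by (simp add: nn_integral_count_space_finite)
  finally show ?thesis .
qed

lemma finite_base_measure: "finite_measure base_measure"
proof
  have "emeasure base_measure (space base_measure) = (\<integral>\<^sup>+z. 1 \<partial>base_measure)"
    by simp
  also have "\<dots> = 2"
    by (subst nn_integral_base_measure)
       (simp_all add: prob_space.emeasure_space_1[OF prob_space_unit_uniform, simplified])
  finally show "emeasure base_measure (space base_measure) \<noteq> \<infinity>" by simp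
qed

lemma integrable_base_bounded:
  fixes g :: "real \<times> nat \<Rightarrow> real"
  assumes "g \<in> borel_measurable base_measure" "\<And>z. z \<in> space base_measure \<Longrightarrow> \<bar>g z\<bar> \<le> C"
  shows "integrable base_measure g"
  using assms by (intro finite_measure.integrable_const_bound[OF finite_base_measure, of _ C]) auto

lemma integrable_unit_bounded:
  fixes g :: "real \<Rightarrow> real"
  assumes "g \<in> borel_measurable unit_uniform" "\<And>x. x \<in> {0..1} \<Longrightarrow> \<bar>g x\<bar> \<le> C"
  shows "integrable unit_uniform g"
  using assms prob_space.finite_measure[OF prob_space_unit_uniform]
  by (intro finite_measure.integrable_const_bound[of _ _ C]) auto

lemma measurable_base_slice:
  assumes "g \<in> borel_measurable base_measure" "y \<in> {0, 1}"
  shows "(\<lambda>x. g (x, y)) \<in> borel_measurable unit_uniform"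
  using assms unfolding base_measure_def
  by (intro measurable_compose[OF measurable_Pair2', of y]) auto

lemma integral_base_measure:
  fixes g :: "real \<times> nat \<Rightarrow> real"
  assumes g: "g \<in> borel_measurable base_measure" "\<And>z. z \<in> space base_measure \<Longrightarrow> \<bar>g z\<bar> \<le> C"
  shows "(\<integral>z. g z \<partial>base_measure) = (\<integral>x. g (x, 0) + g (x, 1) \<partial>unit_uniform)"
proof -
  interpret pair_sigma_finite unit_uniform "count_space {0, 1 :: nat}"
    by (rule pair_sigma_finite_base)
  have "integrable (unit_uniform \<Otimes>\<^sub>M count_space {0, 1}) g"
    using integrable_base_bounded[OF g] by (simp add: base_measure_def)
  then have "(\<integral>z. g z \<partial>base_measure) = (\<integral>x. \<integral>y. g (x, y) \<partial>count_space {0, 1} \<partial>unit_uniform)"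
    unfolding base_measure_def by (rule integral_fst'[symmetric])
  also have "\<dots> = (\<integral>x. g (x, 0) + g (x, 1) \<partial>unit_uniform)"
    by (simp add: lebesgue_integral_count_space_finite)
  finally show ?thesis .
qed

lemma measurable_baseI:
  assumes "(\<lambda>x. g (x, 0)) \<in> measurable unit_uniform N" "(\<lambda>x. g (x, 1)) \<in> measurable unit_uniform N"
  shows "g \<in> measurable base_measure N"
proof -
  have "(\<lambda>z. (\<lambda>y x. g (x, y)) (snd z) (fst z)) \<in> measurable base_measure N"
    unfolding base_measure_def
  proof (rule measurable_compose_countable'[where I = "{0, 1}" and g = snd])
    show "(\<lambda>z. g (fst z, i)) \<in> measurable (unit_uniform \<Otimes>\<^sub>M count_space {0, 1}) N"
      if "i \<in> {0, 1}" for i :: nat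
      using that assms by (auto intro: measurable_compose[OF measurable_fst])
  qed auto
  then show ?thesis by simp
qed

lemma unit_fun_measurable: "f \<in> unit_funs \<Longrightarrow> f \<in> borel_measurable unit_uniform"
  unfolding unit_funs_def measurable_unit_uniform_cong by blast

lemma unit_fun_range:
  assumes "f \<in> unit_funs" "x \<in> {0..1}"
  shows "0 \<le> f x" "f x \<le> 1"
proof -
  have "f x \<in> {0..1}"
    using assms unfolding unit_funs_def by blast
  then show "0 \<le> f x" "f x \<le> 1" by simp_all
qed

lemma dens_simps:
  "x \<in> {0..1} \<Longrightarrow> dens f (x, 0) = 1 - f x"
  "x \<in> {0..1} \<Longrightarrow> dens f (x, 1) = f x"
  "x \<in> {0..1} \<Longrightarrow> dens f (x, Suc 0) = f x"
  by (simp_all add: dens_def)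

lemma base_cases:
  assumes "z \<in> space base_measure"
  obtains x where "x \<in> {0..1}" "z = (x, 0)" | x where "x \<in> {0..1}" "z = (x, 1)"
  using assms by fastforce

lemma dens_bounds:
  assumes "f \<in> unit_funs" "z \<in> space base_measure"
  shows "0 \<le> dens f z" "dens f z \<le> 1"
proof -
  have "0 \<le> dens f z \<and> dens f z \<le> 1"
    using assms(2) by (rule base_cases) (simp_all add: dens_simps unit_fun_range[OF assms(1)])
  then show "0 \<le> dens f z" "dens f z \<le> 1" by simp_all
qed

lemma dens_measurable:
  assumes "f \<in> unit_funs" shows "dens f \<in> borel_measurable base_measure"
proof (rule measurable_baseI)
  note f = unit_fun_measurable[OF assms]
  have "(\<lambda>x. dens f (x, 0)) \<in> borel_measurable unit_uniform \<longleftrightarrow> (\<lambda>x. 1 - f x) \<in> borel_measurable unit_uniform"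
    by (rule measurable_cong) (simp add: dens_simps)
  then show "(\<lambda>x. dens f (x, 0)) \<in> borel_measurable unit_uniform"
    using f by (simp only: borel_measurable_diff borel_measurable_const)
  have "(\<lambda>x. dens f (x, 1)) \<in> borel_measurable unit_uniform \<longleftrightarrow> f \<in> borel_measurable unit_uniform"
    by (rule measurable_cong) (simp add: dens_simps)
  then show "(\<lambda>x. dens f (x, 1)) \<in> borel_measurable unit_uniform"
    using f by simp
qed

lemma densitiesE:
  assumes "g \<in> densities" obtains f where "f \<in> unit_funs" "g = dens f"
  using assms by (auto simp: densities_def)

lemma density_bounds:
  assumes "g \<in> densities" "z \<in> space base_measure"
  shows "0 \<le> g z" "g z \<le> 1"
  using assms dens_bounds by (auto elim!: densitiesE)

lemma density_measurable: "g \<in> densities \<Longrightarrow> g \<in> borel_measurable base_measure"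
  by (auto elim!: densitiesE intro: dens_measurable)

lemma integral_density:
  assumes "g \<in> densities" shows "(\<integral>z. g z \<partial>base_measure) = 1"
proof -
  obtain f where f: "f \<in> unit_funs" "g = dens f" using assms by (rule densitiesE)
  have "(\<integral>z. g z \<partial>base_measure) = (\<integral>x. g (x, 0) + g (x, 1) \<partial>unit_uniform)"
    by (rule integral_base_measure[where C = 1]) 
       (use assms density_bounds[OF assms] in \<open>auto intro: density_measurable simp del: space_base_measure\<close>)
  also have "\<dots> = (\<integral>x. 1 \<partial>unit_uniform)"
    by (rule Bochner_Integration.integral_cong) (auto simp: f dens_simps)
  finally show ?thesis
    using prob_space.prob_space[OF prob_space_unit_uniform] by simp
qed

lemma integrable_density: "g \<in> densities \<Longrightarrow> integrable base_measure g"
  by (rule integrable_base_bounded[where C = 1])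
     (use density_bounds in \<open>auto intro: density_measurable simp del: space_base_measure\<close>)

lemma dens_in_densities: "f \<in> unit_funs \<Longrightarrow> dens f \<in> densities"
  by (simp add: densities_def)

lemma prob_space_data_dist:
  assumes "f0 \<in> unit_funs" shows "prob_space (data_dist f0)"
proof (rule prob_spaceI)
  have "emeasure (data_dist f0) (space (data_dist f0)) = (\<integral>\<^sup>+z. ennreal (dens f0 z) \<partial>base_measure)"
    using assms unfolding data_dist_def
    by (subst emeasure_density) (auto intro!: nn_integral_cong dens_measurable measurable_compose[OF _ measurable_ennreal] simp del: space_base_measure)
  also have "\<dots> = ennreal (\<integral>z. dens f0 z \<partial>base_measure)"
    using assms by (intro nn_integral_eq_integral integrable_density dens_in_densities AE_I2 dens_bounds)
  finally show "emeasure (data_dist f0) (space (data_dist f0)) = 1"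
    using integral_density[OF dens_in_densities[OF assms]] by simp
qed

lemma space_data_dist [simp]: "space (data_dist f0) = {0..1} \<times> {0, 1}"
  by (simp add: data_dist_def)

lemma sets_data_dist [simp]: "sets (data_dist f0) = sets base_measure"
  by (simp add: data_dist_def)

section \<open>Hellinger neighbourhoods and balls in the mean of order p\<close>

text \<open>
  Densities take values in the unit interval, so every measurable function of two of them that is
  bounded on the unit square is integrable.
\<close>

lemma integrable_density_comb:
  fixes \<phi> :: "real \<Rightarrow> real \<Rightarrow> real"
  assumes "f \<in> densities" "g \<in> densities"
    and m: "case_prod \<phi> \<in> borel_measurable (borel \<Otimes>\<^sub>M borel)"
    and b: "\<And>a b. 0 \<le> a \<Longrightarrow> a \<le> 1 \<Longrightarrow> 0 \<le> b \<Longrightarrow> b \<le> 1 \<Longrightarrow> \<bar>\<phi> a b\<bar> \<le> C"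
  shows "integrable base_measure (\<lambda>z. \<phi> (f z) (g z))"
proof (rule integrable_base_bounded)
  have "(\<lambda>z. (f z, g z)) \<in> measurable base_measure (borel \<Otimes>\<^sub>M borel)"
    using assms(1,2) by (intro measurable_Pair density_measurable)
  from measurable_compose[OF this m]
  show "(\<lambda>z. \<phi> (f z) (g z)) \<in> borel_measurable base_measure" by simp
  show "\<bar>\<phi> (f z) (g z)\<bar> \<le> C" if "z \<in> space base_measure" for z
    using that assms(1,2) by (intro b density_bounds)
qed

lemma sqrt_diff_sq_le:
  fixes a b :: real
  assumes "0 \<le> a" "a \<le> 1" "0 \<le> b" "b \<le> 1"
  shows "\<bar>sqrt a - sqrt b\<bar> \<le> 1" "(sqrt a - sqrt b)\<^sup>2 \<le> 1"
proof -
  have "0 \<le> sqrt a" "sqrt a \<le> 1" "0 \<le> sqrt b" "sqrt b \<le> 1" using assms by auto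
  then show *: "\<bar>sqrt a - sqrt b\<bar> \<le> 1" by linarith
  then show "(sqrt a - sqrt b)\<^sup>2 \<le> 1" using power_le_one[of "\<bar>sqrt a - sqrt b\<bar>" 2] by simp
qed

lemma integrable_sqrt_diff:
  assumes "f \<in> densities" "g \<in> densities"
  shows "integrable base_measure (\<lambda>z. (sqrt (f z) - sqrt (g z))\<^sup>2)"
    and "integrable base_measure (\<lambda>z. \<bar>sqrt (f z) - sqrt (g z)\<bar>)"
    and "integrable base_measure (\<lambda>z. \<bar>f z - g z\<bar>)"
proof -
  show "integrable base_measure (\<lambda>z. (sqrt (f z) - sqrt (g z))\<^sup>2)"
    by (rule integrable_density_comb[OF assms, where C = 1]) (measurable, simp add: sqrt_diff_sq_le)
  show "integrable base_measure (\<lambda>z. \<bar>sqrt (f z) - sqrt (g z)\<bar>)"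
    by (rule integrable_density_comb[OF assms, where C = 1]) (measurable, simp add: sqrt_diff_sq_le)
  show "integrable base_measure (\<lambda>z. \<bar>f z - g z\<bar>)"
    by (rule integrable_density_comb[OF assms, where C = 1])
       (auto simp: split_beta' intro!: borel_measurable_abs borel_measurable_diff)
qed

lemma hellinger_nonneg: "0 \<le> hellinger f g"
  by (simp add: hellinger_def)

lemma hellinger_sq: "(hellinger f g)\<^sup>2 = (\<integral>z. (sqrt (f z) - sqrt (g z))\<^sup>2 \<partial>base_measure)"
  by (simp add: hellinger_def)

lemma measure_base: "measure base_measure (space base_measure) = 2"
proof -
  have "measure base_measure (space base_measure) = (\<integral>z. 1 \<partial>base_measure)"
    by simp
  also have "\<dots> = (\<integral>x. 2 \<partial>unit_uniform)"
    by (subst integral_base_measure[where C = 1]) auto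
  finally show ?thesis
    using prob_space.prob_space[OF prob_space_unit_uniform] by simp
qed

text \<open>
  The Hellinger distance dominates the mean distance of the square roots.  The pointwise bound
  \<open>t \<le> e / 2 + t\<^sup>2 / (2 * e)\<close> replaces the Cauchy-Schwarz inequality; the base measure has mass \<open>2\<close>.
\<close>

lemma integral_sqrt_diff_le:
  assumes f: "f \<in> densities" and g: "g \<in> densities" and e: "hellinger f g < e"
  shows "(\<integral>z. \<bar>sqrt (f z) - sqrt (g z)\<bar> \<partial>base_measure) \<le> 3 / 2 * e"
proof -
  have e0: "e > 0" using e hellinger_nonneg[of f g] by linarith
  have "(\<integral>z. \<bar>sqrt (f z) - sqrt (g z)\<bar> \<partial>base_measure)
      \<le> (\<integral>z. e / 2 + (sqrt (f z) - sqrt (g z))\<^sup>2 / (2 * e) \<partial>base_measure)"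
  proof (rule integral_mono)
    show "integrable base_measure (\<lambda>z. \<bar>sqrt (f z) - sqrt (g z)\<bar>)"
      by (rule integrable_sqrt_diff[OF f g])
    show "integrable base_measure (\<lambda>z. e / 2 + (sqrt (f z) - sqrt (g z))\<^sup>2 / (2 * e))"
      by (intro Bochner_Integration.integrable_add integrable_divide integrable_sqrt_diff f g
            finite_measure.integrable_const finite_base_measure)
    show "\<bar>sqrt (f z) - sqrt (g z)\<bar> \<le> e / 2 + (sqrt (f z) - sqrt (g z))\<^sup>2 / (2 * e)" for z
    proof -
      have "0 \<le> (\<bar>sqrt (f z) - sqrt (g z)\<bar> - e)\<^sup>2" by simp
      then have "2 * e * \<bar>sqrt (f z) - sqrt (g z)\<bar> \<le> e * e + (sqrt (f z) - sqrt (g z))\<^sup>2"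
        by (simp add: power2_diff) (simp add: power2_eq_square algebra_simps)
      then show ?thesis using e0 by (simp add: field_simps)
    qed
  qed
  also have "\<dots> = e + (hellinger f g)\<^sup>2 / (2 * e)"
    by (subst Bochner_Integration.integral_add)
       (auto intro!: integrable_divide integrable_sqrt_diff f g
          finite_measure.integrable_const finite_base_measure
         simp del: space_base_measure simp add: hellinger_sq measure_base)
  also have "\<dots> \<le> e + e\<^sup>2 / (2 * e)"
    using e0 e hellinger_nonneg[of f g] by (intro add_left_mono divide_right_mono power_mono) auto
  also have "\<dots> = 3 / 2 * e" using e0 by (simp add: power2_eq_square)
  finally show ?thesis .
qed

lemma integrable_unit_fun_comb:
  fixes \<phi> :: "real \<Rightarrow> real \<Rightarrow> real"
  assumes "f \<in> unit_funs" "g \<in> unit_funs"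
    and m: "case_prod \<phi> \<in> borel_measurable (borel \<Otimes>\<^sub>M borel)"
    and b: "\<And>a b. 0 \<le> a \<Longrightarrow> a \<le> 1 \<Longrightarrow> 0 \<le> b \<Longrightarrow> b \<le> 1 \<Longrightarrow> \<bar>\<phi> a b\<bar> \<le> C"
  shows "integrable unit_uniform (\<lambda>z. \<phi> (f z) (g z))"
proof (rule integrable_unit_bounded)
  have "(\<lambda>z. (f z, g z)) \<in> measurable unit_uniform (borel \<Otimes>\<^sub>M borel)"
    using assms(1,2) by (intro measurable_Pair unit_fun_measurable)
  from measurable_compose[OF this m]
  show "(\<lambda>z. \<phi> (f z) (g z)) \<in> borel_measurable unit_uniform" by simp
  show "\<bar>\<phi> (f z) (g z)\<bar> \<le> C" if "z \<in> {0..1}" for z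
    using that assms(1,2) by (intro b unit_fun_range)
qed

lemma integral_abs_dens_diff:
  assumes f: "f \<in> unit_funs" and g: "g \<in> unit_funs"
  shows "(\<integral>z. \<bar>dens f z - dens g z\<bar> \<partial>base_measure) = 2 * (\<integral>x. \<bar>f x - g x\<bar> \<partial>unit_uniform)"
proof -
  have "(\<integral>z. \<bar>dens f z - dens g z\<bar> \<partial>base_measure)
      = (\<integral>x. \<bar>dens f (x, 0) - dens g (x, 0)\<bar> + \<bar>dens f (x, 1) - dens g (x, 1)\<bar> \<partial>unit_uniform)"
  proof (rule integral_base_measure)
    show "(\<lambda>z. \<bar>dens f z - dens g z\<bar>) \<in> borel_measurable base_measure"
      using integrable_sqrt_diff(3)[OF dens_in_densities[OF f] dens_in_densities[OF g]]
      by (rule borel_measurable_integrable)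
    show "\<bar>\<bar>dens f z - dens g z\<bar>\<bar> \<le> 1" if "z \<in> space base_measure" for z
      using dens_bounds[OF f that] dens_bounds[OF g that] by linarith
  qed
  also have "\<dots> = (\<integral>x. 2 * \<bar>f x - g x\<bar> \<partial>unit_uniform)"
    by (rule Bochner_Integration.integral_cong) (auto simp: dens_simps)
  finally show ?thesis by simp
qed

text \<open>
  The factor \<open>sqrt a + sqrt b \<le> 2\<close> of \<open>a - b\<close> reduces this to the distance of the square roots.
\<close>

lemma integral_abs_diff_le:
  assumes f: "f \<in> unit_funs" and g: "g \<in> unit_funs" and e: "hellinger (dens f) (dens g) < e"
  shows "(\<integral>x. \<bar>f x - g x\<bar> \<partial>unit_uniform) \<le> 3 / 2 * e"
proof -
  note d = dens_in_densities[OF f] dens_in_densities[OF g]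
  have "2 * (\<integral>x. \<bar>f x - g x\<bar> \<partial>unit_uniform) = (\<integral>z. \<bar>dens f z - dens g z\<bar> \<partial>base_measure)"
    by (rule integral_abs_dens_diff[OF f g, symmetric])
  also have "\<dots> \<le> (\<integral>z. 2 * \<bar>sqrt (dens f z) - sqrt (dens g z)\<bar> \<partial>base_measure)"
  proof (rule integral_mono)
    fix z assume z: "z \<in> space base_measure"
    let ?a = "sqrt (dens f z)" and ?b = "sqrt (dens g z)"
    have ab: "0 \<le> ?a" "?a \<le> 1" "0 \<le> ?b" "?b \<le> 1"
      using dens_bounds[OF f z] dens_bounds[OF g z] by simp_all
    have "dens f z - dens g z = (?a + ?b) * (?a - ?b)"
      using dens_bounds[OF f z] dens_bounds[OF g z] by (simp add: algebra_simps)
    then have "\<bar>dens f z - dens g z\<bar> = (?a + ?b) * \<bar>?a - ?b\<bar>"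
      using ab by (simp add: abs_mult)
    also have "\<dots> \<le> 2 * \<bar>?a - ?b\<bar>"
      using ab by (intro mult_right_mono) linarith+
    finally show "\<bar>dens f z - dens g z\<bar> \<le> 2 * \<bar>?a - ?b\<bar>" .
  qed (use integrable_sqrt_diff[OF d] in auto)
  also have "\<dots> \<le> 2 * (3 / 2 * e)"
    using integral_sqrt_diff_le[OF d e] by simp
  finally show ?thesis by simp
qed

lemma hellinger_open_in_borel:
  assumes "U \<subseteq> densities"
    "\<And>f. f \<in> U \<Longrightarrow> \<exists>e>0. \<forall>g\<in>densities. hellinger f g < e \<longrightarrow> g \<in> U"
  shows "U \<in> sets hellinger_borel"
  unfolding hellinger_borel_def using assms by (subst sets_measure_of) auto

lemma space_hellinger_borel [simp]: "space hellinger_borel = densities"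
  unfolding hellinger_borel_def by (rule space_measure_of) auto

text \<open>
  The complement is open.  Since \<open>(c - a)\<^sup>2 - (c - b)\<^sup>2\<close> is at most \<open>2 * \<bar>a - b\<bar>\<close> for numbers in the unit
  interval, the squared distance to \<open>dens f0\<close> changes by at most \<open>3 * e\<close> when a density moves by less
  than \<open>e\<close>.
\<close>

lemma hellinger_nbhd_borel:
  assumes "f0 \<in> unit_funs"
  shows "hellinger_nbhd f0 \<epsilon> \<in> sets hellinger_borel"
proof -
  note d0 = dens_in_densities[OF assms]
  let ?U = "{f \<in> densities. hellinger (dens f0) f > \<epsilon>}"
  have "?U \<in> sets hellinger_borel"
  proof (rule hellinger_open_in_borel)
    fix f assume "f \<in> ?U"
    then have f: "f \<in> densities" and lt: "\<epsilon> < hellinger (dens f0) f" by auto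
    have "\<exists>e>0. \<forall>g\<in>densities. hellinger f g < e \<longrightarrow> \<epsilon> < hellinger (dens f0) g"
    proof (cases "\<epsilon> < 0")
      case True
      then show ?thesis using hellinger_nonneg
        by (intro exI[of _ 1]) (auto intro: less_le_trans)
    next
      case False
      define e where "e = ((hellinger (dens f0) f)\<^sup>2 - \<epsilon>\<^sup>2) / 4"
      have e: "e > 0"
        using lt False by (simp add: e_def power_strict_mono)
      have "\<epsilon> < hellinger (dens f0) g" if g: "g \<in> densities" and h: "hellinger f g < e" for g
      proof -
        have "(hellinger (dens f0) f)\<^sup>2 - (hellinger (dens f0) g)\<^sup>2
          = (\<integral>z. (sqrt (dens f0 z) - sqrt (f z))\<^sup>2 - (sqrt (dens f0 z) - sqrt (g z))\<^sup>2 \<partial>base_measure)"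
          unfolding hellinger_sq
          by (rule Bochner_Integration.integral_diff[symmetric]) (intro integrable_sqrt_diff d0 f g)+
        also have "\<dots> \<le> (\<integral>z. 2 * \<bar>sqrt (f z) - sqrt (g z)\<bar> \<partial>base_measure)"
        proof (rule integral_mono)
          fix z assume z: "z \<in> space base_measure"
          let ?a = "sqrt (f z)" and ?b = "sqrt (g z)" and ?c = "sqrt (dens f0 z)"
          have ab: "0 \<le> ?a" "?a \<le> 1" "0 \<le> ?b" "?b \<le> 1" "0 \<le> ?c" "?c \<le> 1"
            using density_bounds[OF f z] density_bounds[OF g z] density_bounds[OF d0 z] by auto
          have "(?c - ?a)\<^sup>2 - (?c - ?b)\<^sup>2 = (?a + ?b - 2 * ?c) * (?a - ?b)"
            by (simp add: power2_eq_square algebra_simps)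
          also have "\<dots> \<le> \<bar>?a + ?b - 2 * ?c\<bar> * \<bar>?a - ?b\<bar>"
            by (metis abs_ge_self abs_mult)
          also have "\<dots> \<le> 2 * \<bar>?a - ?b\<bar>"
            using ab by (intro mult_right_mono) linarith+
          finally show "(?c - ?a)\<^sup>2 - (?c - ?b)\<^sup>2 \<le> 2 * \<bar>?a - ?b\<bar>" .
        qed (use integrable_sqrt_diff[OF d0 f] integrable_sqrt_diff[OF d0 g]
              integrable_sqrt_diff[OF f g] in auto)
        also have "\<dots> \<le> 3 * e"
          using integral_sqrt_diff_le[OF f g h] by simp
        finally have "\<epsilon>\<^sup>2 < (hellinger (dens f0) g)\<^sup>2"
          using e unfolding e_def by argo
        then show ?thesis
          using hellinger_nonneg power2_less_imp_less by blast
      qed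
      then show ?thesis using e by blast
    qed
    then show "\<exists>e>0. \<forall>g\<in>densities. hellinger f g < e \<longrightarrow> g \<in> ?U" by auto
  qed auto
  then have "space hellinger_borel - ?U \<in> sets hellinger_borel" by (rule sets.compl_sets)
  moreover have "space hellinger_borel - ?U = hellinger_nbhd f0 \<epsilon>"
    by (auto simp: hellinger_nbhd_def)
  ultimately show ?thesis by simp
qed

text \<open>
  On the unit interval the function \<open>t powr p\<close> has derivative at most \<open>p\<close>.
\<close>

lemma powr_diff_le:
  fixes a b p :: real
  assumes "1 \<le> p" "0 \<le> a" "a \<le> 1" "0 \<le> b" "b \<le> 1"
  shows "a powr p - b powr p \<le> p * \<bar>a - b\<bar>"
proof (cases "a \<le> b")
  case True
  then have "a powr p \<le> b powr p" using assms by (intro powr_mono2) auto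
  moreover have "0 \<le> p * \<bar>a - b\<bar>" using assms by simp
  ultimately show ?thesis by linarith
next
  case False
  show ?thesis
  proof (cases "b = 0")
    case True
    have "a powr p \<le> a powr 1" using assms by (intro powr_mono') auto
    also have "\<dots> \<le> p * a" using assms by (simp add: mult_right_mono[of 1 p a, simplified])
    finally show ?thesis using True assms by simp
  next
    case b: False
    have "\<exists>z. b < z \<and> z < a \<and> a powr p - b powr p = (a - b) * (p * z powr (p - 1))"
      using False b assms by (intro MVT2) (auto intro!: has_real_derivative_powr)
    then obtain z where z: "b < z" "z < a" "a powr p - b powr p = (a - b) * (p * z powr (p - 1))"
      by blast
    have "z powr (p - 1) \<le> 1 powr (p - 1)" using z assms by (intro powr_mono2) auto
    then have "(a - b) * (p * z powr (p - 1)) \<le> (a - b) * (p * 1)"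
      using False assms by (intro mult_left_mono) auto
    then show ?thesis using z False by (simp add: mult.commute)
  qed
qed

lemma lp_norm_less_iff:
  assumes "p \<ge> 1" "\<epsilon> > 0"
  shows "lp_norm p f < \<epsilon> \<longleftrightarrow> (\<integral>x. \<bar>f x\<bar> powr p \<partial>unit_uniform) < \<epsilon> powr p"
proof -
  let ?I = "\<integral>x. \<bar>f x\<bar> powr p \<partial>unit_uniform"
  have I: "0 \<le> ?I" by (rule Bochner_Integration.integral_nonneg) simp
  have "\<epsilon> = (\<epsilon> powr p) powr (1 / p)" using assms by (simp add: powr_powr)
  then have "lp_norm p f < \<epsilon> \<longleftrightarrow> ?I powr (1 / p) < (\<epsilon> powr p) powr (1 / p)"
    unfolding lp_norm_def by simp
  also have "\<dots> \<longleftrightarrow> ?I < \<epsilon> powr p"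
    using I assms powr_less_mono2[of "1 / p" ?I "\<epsilon> powr p"] powr_mono2[of "1 / p" "\<epsilon> powr p" ?I]
    by (auto simp: not_less[symmetric])
  finally show ?thesis .
qed

abbreviation lp_ball :: "(real \<Rightarrow> real) \<Rightarrow> real \<Rightarrow> real \<Rightarrow> (real \<times> nat \<Rightarrow> real) set" where
  "lp_ball f0 p \<epsilon> \<equiv> {dens f | f. f \<in> unit_funs \<and> lp_norm p (\<lambda>x. f x - f0 x) < \<epsilon>}"

lemma integrable_abs_powr:
  assumes "p \<ge> 1" "f \<in> unit_funs" "g \<in> unit_funs"
  shows "integrable unit_uniform (\<lambda>x. \<bar>f x - g x\<bar> powr p)"
    "integrable unit_uniform (\<lambda>x. \<bar>f x - g x\<bar>)"
proof -
  have "\<bar>\<bar>a - b\<bar> powr p\<bar> \<le> 1" if "0 \<le> a" "a \<le> 1" "0 \<le> b" "b \<le> 1" for a b :: real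
    using that assms(1) powr_mono2[of p "\<bar>a - b\<bar>" 1] by auto
  then show "integrable unit_uniform (\<lambda>x. \<bar>f x - g x\<bar> powr p)"
    by (intro integrable_unit_fun_comb[OF assms(2,3), where C = 1])
       (auto simp: split_beta' intro!: powr_real_measurable borel_measurable_abs borel_measurable_diff)
  show "integrable unit_uniform (\<lambda>x. \<bar>f x - g x\<bar>)"
    by (rule integrable_unit_fun_comb[OF assms(2,3), where C = 1])
       (auto simp: split_beta' intro!: borel_measurable_abs borel_measurable_diff)
qed

text \<open>
  The \<open>p\<close>-th power of the \<open>L\<^sup>p\<close> distance to \<open>f0\<close> is a Lipschitz function for the Hellinger distance.  Both the
  openness of \<open>L\<^sup>p\<close> balls and the Hellinger balls inside them come from this.
\<close>

lemma integral_powr_diff_le: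
  assumes p: "p \<ge> 1" and f: "f \<in> unit_funs" and g: "g \<in> unit_funs" and f0: "f0 \<in> unit_funs"
    and e: "hellinger (dens f) (dens g) < e"
  shows "(\<integral>x. \<bar>g x - f0 x\<bar> powr p \<partial>unit_uniform)
      \<le> (\<integral>x. \<bar>f x - f0 x\<bar> powr p \<partial>unit_uniform) + p * (3 / 2 * e)"
proof -
  have "(\<integral>x. \<bar>g x - f0 x\<bar> powr p \<partial>unit_uniform)
      \<le> (\<integral>x. \<bar>f x - f0 x\<bar> powr p + p * \<bar>f x - g x\<bar> \<partial>unit_uniform)"
  proof (rule integral_mono)
    fix x assume "x \<in> space unit_uniform"
    then have x: "x \<in> {0..1}" by simp
    note b = unit_fun_range[OF f x] unit_fun_range[OF g x] unit_fun_range[OF f0 x]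
    have "\<bar>g x - f0 x\<bar> powr p - \<bar>f x - f0 x\<bar> powr p \<le> p * \<bar>\<bar>g x - f0 x\<bar> - \<bar>f x - f0 x\<bar>\<bar>"
      using b p by (intro powr_diff_le) linarith+
    also have "\<dots> \<le> p * \<bar>f x - g x\<bar>"
      using p by (intro mult_left_mono) linarith+
    finally show "\<bar>g x - f0 x\<bar> powr p \<le> \<bar>f x - f0 x\<bar> powr p + p * \<bar>f x - g x\<bar>" by linarith
  qed (use integrable_abs_powr[OF p] f g f0 in auto)
  also have "\<dots> = (\<integral>x. \<bar>f x - f0 x\<bar> powr p \<partial>unit_uniform) + p * (\<integral>x. \<bar>f x - g x\<bar> \<partial>unit_uniform)"
    using integrable_abs_powr[OF p] f g f0 by simp
  also have "\<dots> \<le> (\<integral>x. \<bar>f x - f0 x\<bar> powr p \<partial>unit_uniform) + p * (3 / 2 * e)"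
    using p integral_abs_diff_le[OF f g e] by simp
  finally show ?thesis .
qed

lemma lp_ball_borel:
  assumes p: "p \<ge> 1" and f0: "f0 \<in> unit_funs" and \<epsilon>: "\<epsilon> > 0"
  shows "lp_ball f0 p \<epsilon> \<in> sets hellinger_borel"
proof (rule hellinger_open_in_borel)
  show "lp_ball f0 p \<epsilon> \<subseteq> densities" by (auto simp: densities_def)
  fix F assume "F \<in> lp_ball f0 p \<epsilon>"
  then obtain f where f: "f \<in> unit_funs" "F = dens f"
    and lt: "(\<integral>x. \<bar>f x - f0 x\<bar> powr p \<partial>unit_uniform) < \<epsilon> powr p"
    using lp_norm_less_iff[OF p \<epsilon>] by auto
  define e where "e = (\<epsilon> powr p - (\<integral>x. \<bar>f x - f0 x\<bar> powr p \<partial>unit_uniform)) / (2 * p)"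
  have e: "e > 0" "2 * p * e = \<epsilon> powr p - (\<integral>x. \<bar>f x - f0 x\<bar> powr p \<partial>unit_uniform)"
    using lt p by (auto simp: e_def)
  have "dens g \<in> lp_ball f0 p \<epsilon>" if g: "g \<in> unit_funs" "hellinger (dens f) (dens g) < e" for g
  proof -
    have "p * (3 / 2 * e) < 2 * p * e" using p e(1) by simp
    then have "(\<integral>x. \<bar>g x - f0 x\<bar> powr p \<partial>unit_uniform) < \<epsilon> powr p"
      using integral_powr_diff_le[OF p f(1) g(1) f0 g(2)] e(2) by linarith
    then show ?thesis using lp_norm_less_iff[OF p \<epsilon>] g(1) by auto
  qed
  then show "\<exists>e>0. \<forall>g\<in>densities. hellinger F g < e \<longrightarrow> g \<in> lp_ball f0 p \<epsilon>"
    using e(1) f(2) by (intro exI[of _ e]) (auto simp only: densities_def image_iff)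
qed

text \<open>
  The posterior mass of an \<open>L\<^sup>p\<close> ball is thus bounded below by that of a Hellinger ball.
\<close>

lemma hellinger_nbhd_subset_lp_ball:
  assumes p: "p \<ge> 1" and f0: "f0 \<in> unit_funs" and \<epsilon>: "\<epsilon> > 0"
  shows "hellinger_nbhd f0 (\<epsilon> powr p / (2 * p)) \<subseteq> lp_ball f0 p \<epsilon>"
proof
  fix F assume "F \<in> hellinger_nbhd f0 (\<epsilon> powr p / (2 * p))"
  then obtain f where f: "f \<in> unit_funs" "F = dens f"
    and h: "hellinger (dens f0) (dens f) \<le> \<epsilon> powr p / (2 * p)"
    by (auto simp: hellinger_nbhd_def elim: densitiesE)
  have "\<epsilon> powr p / (2 * p) < \<epsilon> powr p / (8 / 5 * p)"
    using p \<epsilon> by (intro divide_strict_left_mono) auto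
  then have "hellinger (dens f0) (dens f) < \<epsilon> powr p / (8 / 5 * p)" using h by linarith
  from integral_powr_diff_le[OF p f0 f(1) f0 this]
  have "(\<integral>x. \<bar>f x - f0 x\<bar> powr p \<partial>unit_uniform) \<le> p * (3 / 2 * (\<epsilon> powr p / (8 / 5 * p)))"
    using p by simp
  also have "\<dots> = 15 / 16 * \<epsilon> powr p" using p by simp
  also have "\<dots> < \<epsilon> powr p" using \<epsilon> by simp
  finally show "F \<in> lp_ball f0 p \<epsilon>"
    using lp_norm_less_iff[OF p \<epsilon>] f by auto
qed

section \<open>Step functions and the prior\<close>

text \<open>
  The number of split points up to \<open>x\<close>.  It identifies the piece that contains \<open>x\<close> without sorting
  the split points, also when some of them coincide.
\<close>

definition count_below :: "nat \<Rightarrow> (nat \<Rightarrow> real) \<Rightarrow> real \<Rightarrow> nat" where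
  "count_below k v x = card {j \<in> {1..<k}. v j \<le> x}"

lemma count_below_less: "k \<ge> 1 \<Longrightarrow> count_below k v x < k"
proof -
  assume "k \<ge> 1"
  have "card {j \<in> {1..<k}. v j \<le> x} \<le> card {1..<k}" by (rule card_mono) auto
  then show ?thesis using \<open>k \<ge> 1\<close> by (simp add: count_below_def)
qed

text \<open>
  In a sorted list the entries up to \<open>x\<close> form an initial segment.
\<close>

lemma sorted_nth_le_iff:
  fixes xs :: "'a::linorder list"
  assumes "sorted xs" "i < length xs"
  shows "xs ! i \<le> x \<longleftrightarrow> i < length (filter (\<lambda>a. a \<le> x) xs)"
  using assms
proof (induction xs arbitrary: i)
  case (Cons a xs)
  show ?case
  proof (cases "a \<le> x")
    case True
    then show ?thesis using Cons by (cases i) auto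
  next
    case False
    then have "filter (\<lambda>a. a \<le> x) (a # xs) = []"
      using Cons.prems(1) by (auto simp: filter_empty_conv)
    moreover have "a \<le> (a # xs) ! i"
      using Cons.prems by (cases i) auto
    ultimately show ?thesis using False by auto
  qed
qed simp

lemma length_filter_sort_map:
  "length (filter (\<lambda>a. a \<le> x) (sort (map v [1..<k]))) = count_below k v x"
proof -
  have "length (filter (\<lambda>a. a \<le> x) (sort (map v [1..<k])))
      = length (filter (\<lambda>a. a \<le> x) (map v [1..<k]))"
    by (simp add: filter_sort)
  also have "\<dots> = length (filter (\<lambda>j. v j \<le> x) [1..<k])"
    by (simp add: filter_map o_def)
  also have "\<dots> = card (set (filter (\<lambda>j. v j \<le> x) [1..<k]))"
    by (rule distinct_card[symmetric]) simp
  finally show ?thesis by (simp add: count_below_def)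
qed

lemma ordered_value_le_iff:
  assumes "1 \<le> i" "i < k"
  shows "ordered_value k v i \<le> x \<longleftrightarrow> i \<le> count_below k v x"
proof -
  have "sort (map v [1..<k]) ! (i - 1) \<le> x \<longleftrightarrow> i - 1 < count_below k v x"
    by (subst length_filter_sort_map[symmetric], rule sorted_nth_le_iff) (use assms in auto)
  then show ?thesis using assms unfolding ordered_value_def by auto
qed

lemma mem_piece_iff:
  assumes "x \<in> {0..1}" "1 \<le> i" "i \<le> k"
  shows "x \<in> piece k v i \<longleftrightarrow> count_below k v x = i - 1"
proof (cases "k = 1")
  case True
  then show ?thesis using assms by (auto simp: piece_def count_below_def)
next
  case False
  have c: "count_below k v x < k" using assms by (intro count_below_less) auto
  consider "i = 1" | "i \<noteq> 1" "i = k" | "1 < i" "i < k" using assms by linarith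
  then show ?thesis
  proof cases
    case 1
    then show ?thesis
      using assms False ordered_value_le_iff[of 1 k v x]
      by (auto simp: piece_def not_le[symmetric])
  next
    case 2
    then show ?thesis
      using assms False c ordered_value_le_iff[of "k - 1" k v x]
      by (auto simp: piece_def)
  next
    case 3
    then show ?thesis
      using assms False c ordered_value_le_iff[of "i - 1" k v x] ordered_value_le_iff[of i k v x]
      by (auto simp: piece_def not_le[symmetric])
  qed
qed

text \<open>
  The formula through which step functions are used from here on: measurability, continuity in the
  parameters and constancy between split points are all visible from it.
\<close>

lemma step_fun_eq:
  assumes "x \<in> {0..1}" "k \<ge> 1"
  shows "step_fun (k, v, s) x = s (Suc (count_below k v x))"
proof -
  have c: "count_below k v x < k" using assms(2) by (rule count_below_less)
  have "step_fun (k, v, s) x = (\<Sum>i=1..k. s i * indicator (piece k v i) x)"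
    using assms by (simp add: step_fun_def)
  also have "\<dots> = (\<Sum>i=1..k. if i = Suc (count_below k v x) then s i else 0)"
  proof (rule sum.cong)
    fix i assume "i \<in> {1..k}"
    then have "x \<in> piece k v i \<longleftrightarrow> i = Suc (count_below k v x)"
      using mem_piece_iff[OF assms(1), of i k v] by auto
    then show "s i * indicator (piece k v i) x = (if i = Suc (count_below k v x) then s i else 0)"
      by (simp add: indicator_def)
  qed simp
  also have "\<dots> = s (Suc (count_below k v x))"
    using c by (subst sum.delta) auto
  finally show ?thesis .
qed

lemma step_fun_zero: "step_fun (0, v, s) = restrict (\<lambda>x. 0) {0..1}"
proof -
  have "{1..0::nat} = {}" by simp
  then show ?thesis unfolding step_fun_def by (simp only: prod.case sum.empty)
qed

text \<open>
  The law of split points and values given the number \<open>k\<close> of pieces.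
\<close>

definition params :: "nat \<Rightarrow> ((nat \<Rightarrow> real) \<times> (nat \<Rightarrow> real)) measure" where
  "params k = (\<Pi>\<^sub>M i\<in>{1..<k}. unit_uniform) \<Otimes>\<^sub>M (\<Pi>\<^sub>M i\<in>{1..k}. unit_uniform)"

abbreviation step_dens :: "nat \<Rightarrow> (nat \<Rightarrow> real) \<times> (nat \<Rightarrow> real) \<Rightarrow> real \<times> nat \<Rightarrow> real" where
  "step_dens k w \<equiv> dens (step_fun (k, w))"

lemma space_params:
  "space (params k) = ({1..<k} \<rightarrow>\<^sub>E {0..1}) \<times> ({1..k} \<rightarrow>\<^sub>E {0..1})"
  by (simp add: params_def space_pair_measure space_PiM)

lemma prob_space_params: "prob_space (params k)"
proof -
  have "prob_space (\<Pi>\<^sub>M i\<in>I. unit_uniform)" for I :: "nat set"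
    by (intro prob_space_PiM prob_space_unit_uniform)
  then interpret pair_prob_space "\<Pi>\<^sub>M i\<in>{1..<k}. unit_uniform" "\<Pi>\<^sub>M i\<in>{1..k}. unit_uniform"
    by (simp add: pair_prob_space_def pair_sigma_finite_def prob_space_imp_sigma_finite)
  show ?thesis unfolding params_def by (rule prob_space_axioms)
qed

lemma measurable_id_unit: "(\<lambda>x. x) \<in> borel_measurable unit_uniform"
  by (intro borel_imp_unit_measurable measurable_ident_sets refl)

lemma measurable_split_coord:
  assumes "j \<in> {1..<k}" shows "(\<lambda>w. fst w j) \<in> borel_measurable (params k)"
proof -
  have "(\<lambda>v. v j) \<in> borel_measurable (\<Pi>\<^sub>M i\<in>{1..<k}. unit_uniform)"
    using measurable_compose[OF measurable_component_singleton[OF assms, of "\<lambda>_. unit_uniform"] measurable_id_unit] .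
  from measurable_compose[OF measurable_fst this] show ?thesis unfolding params_def .
qed

lemma measurable_value_coord:
  assumes "j \<in> {1..k}" shows "(\<lambda>w. snd w j) \<in> borel_measurable (params k)"
proof -
  have "(\<lambda>v. v j) \<in> borel_measurable (\<Pi>\<^sub>M i\<in>{1..k}. unit_uniform)"
    using measurable_compose[OF measurable_component_singleton[OF assms, of "\<lambda>_. unit_uniform"] measurable_id_unit] .
  from measurable_compose[OF measurable_snd this] show ?thesis unfolding params_def .
qed

lemma measurable_count_below_params:
  "(\<lambda>w. count_below k (fst w) x) \<in> measurable (params k) (count_space UNIV)"
  unfolding count_below_def
proof (rule measurable_card)
  fix j
  show "{w \<in> space (params k). j \<in> {j \<in> {1..<k}. fst w j \<le> x}} \<in> sets (params k)"
  proof (cases "j \<in> {1..<k}")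
    case True
    then have "{w \<in> space (params k). j \<in> {j \<in> {1..<k}. fst w j \<le> x}}
        = (\<lambda>w. fst w j) -` {..x} \<inter> space (params k)" by blast
    then show ?thesis using measurable_sets[OF measurable_split_coord[OF True], of "{..x}"] by simp
  next
    case False
    then have "{w \<in> space (params k). j \<in> {j \<in> {1..<k}. fst w j \<le> x}} = {}" by blast
    then show ?thesis by (simp only: sets.empty_sets)
  qed
qed

text \<open>
  For fixed \<open>x\<close>, the value at \<open>x\<close> is the coordinate of \<open>s\<close> selected by the measurable index
  \<open>count_below k v x\<close>.
\<close>

lemma measurable_step_fun_params:
  "(\<lambda>w. step_fun (k, w) x) \<in> borel_measurable (params k)"
proof (cases "x \<in> {0..1} \<and> k \<ge> 1")
  case True
  have "(\<lambda>w. snd w (Suc (count_below k (fst w) x))) \<in> borel_measurable (params k)"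
  proof -
    let ?f = "\<lambda>i w. if i < k then snd w (Suc i) else (0 :: real)"
    have "?f i \<in> borel_measurable (params k)" for i
    proof (cases "i < k")
      case True
      then have "Suc i \<in> {1..k}" by auto
      then show ?thesis unfolding if_P[OF True] by (rule measurable_value_coord)
    next
      case False
      show ?thesis unfolding if_not_P[OF False] by (rule borel_measurable_const)
    qed
    then have "(\<lambda>w. ?f (count_below k (fst w) x) w) \<in> borel_measurable (params k)"
      by (rule measurable_compose_countable'[OF _ measurable_count_below_params]) simp
    moreover have "k \<ge> 1" using True by blast
    ultimately show ?thesis unfolding if_P[OF count_below_less[OF \<open>k \<ge> 1\<close>]] by blast
  qed
  moreover have eq: "step_fun (k, w) x = snd w (Suc (count_below k (fst w) x))" for w
    using True step_fun_eq[of x k "fst w" "snd w"] by simp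
  ultimately show ?thesis unfolding eq by blast
next
  case False
  define c where "c = (if x \<in> {0..1} then 0 else (undefined :: real))"
  have "step_fun (k, v, s) x = c" for v s
  proof (cases "k = 0")
    case True
    then show ?thesis by (simp only: step_fun_zero restrict_def c_def)
  next
    case k: False
    then have "x \<notin> {0..1}" using False by auto
    then show ?thesis unfolding step_fun_def prod.case restrict_def c_def by (simp only: if_False)
  qed
  then have eq: "step_fun (k, w) x = c" for w
    by (metis surj_pair)
  show ?thesis unfolding eq by (rule borel_measurable_const)
qed

lemma measurable_count_below:
  "(\<lambda>x. count_below k v x) \<in> measurable borel (count_space UNIV)"
  unfolding count_below_def
proof (rule measurable_card)
  fix j
  have "{x \<in> space borel. j \<in> {j \<in> {1..<k}. v j \<le> x}} = (if j \<in> {1..<k} then {v j..} else {})"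
    by auto
  then show "{x \<in> space borel. j \<in> {j \<in> {1..<k}. v j \<le> x}} \<in> sets borel" by simp
qed

lemma step_fun_unit_funs:
  assumes "w \<in> space (params k)" shows "step_fun (k, w) \<in> unit_funs"
proof (cases "k \<ge> 1")
  case True
  obtain v s where w: "w = (v, s)" by (cases w)
  have eq: "step_fun (k, w) x = s (Suc (count_below k v x))" if "x \<in> {0..1}" for x
    using step_fun_eq[OF that True] w by simp
  have s: "s \<in> {1..k} \<rightarrow>\<^sub>E {0..1}" using assms by (simp add: space_params w)
  have "s (Suc (count_below k v x)) \<in> {0..1}" for x
    using s count_below_less[OF True, of v x] by (intro PiE_mem[OF s]) auto
  then have "step_fun (k, w) \<in> {0..1} \<rightarrow>\<^sub>E {0..1}"
    using eq w by (intro PiE_I) (auto simp: step_fun_def)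
  moreover have "(\<lambda>x. s (Suc (count_below k v x))) \<in> borel_measurable borel"
    by (rule measurable_compose[OF measurable_count_below]) simp
  then have "(\<lambda>x. s (Suc (count_below k v x))) \<in> borel_measurable (restrict_space borel {0..1})"
    by (rule measurable_restrict_space1)
  then have "step_fun (k, w) \<in> borel_measurable (restrict_space borel {0..1})"
    by (subst measurable_cong[where g = "\<lambda>x. s (Suc (count_below k v x))"])
       (auto simp: eq space_restrict_space)
  ultimately show ?thesis by (simp add: unit_funs_def)
next
  case False
  then have "k = 0" by simp
  then have "step_fun (k, w) = restrict (\<lambda>x. 0) {0..1}"
    by (cases w) (simp add: step_fun_zero)
  moreover have "restrict (\<lambda>x. 0 :: real) {0..1} \<in> borel_measurable (restrict_space borel {0..1})"
    by (subst measurable_cong[where g = "\<lambda>x. 0"]) (auto simp: space_restrict_space)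
  ultimately show ?thesis by (simp add: unit_funs_def)
qed

lemma tendsto_coordinate:
  fixes X :: "nat \<Rightarrow> nat \<Rightarrow> real"
  assumes "X \<longlonglongrightarrow> v" shows "(\<lambda>n. X n j) \<longlonglongrightarrow> v j"
  using continuous_on_tendsto_compose[OF continuous_on_product_coordinates assms, of j] by simp

text \<open>
  Away from the split points of the limit, the counts of split points agree from some index on.
\<close>

lemma step_fun_tendsto:
  assumes k: "k \<ge> 1" and x: "x \<in> {0..1}" and ne: "\<And>j. j \<in> {1..<k} \<Longrightarrow> x \<noteq> v j"
    and V: "V \<longlonglongrightarrow> v" and S: "S \<longlonglongrightarrow> s"
  shows "(\<lambda>n. step_fun (k, V n, S n) x) \<longlonglongrightarrow> step_fun (k, v, s) x"
proof -
  have "eventually (\<lambda>n. V n j \<le> x \<longleftrightarrow> v j \<le> x) sequentially" if j: "j \<in> {1..<k}" for j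
  proof (cases "v j \<le> x")
    case True
    then have "eventually (\<lambda>n. V n j < x) sequentially"
      using order_tendstoD(2)[OF tendsto_coordinate[OF V]] ne[OF j] by force
    then show ?thesis by eventually_elim (use True in simp)
  next
    case False
    then have "eventually (\<lambda>n. V n j > x) sequentially"
      using order_tendstoD(1)[OF tendsto_coordinate[OF V]] by force
    then show ?thesis by eventually_elim (use False in simp)
  qed
  then have "eventually (\<lambda>n. \<forall>j\<in>{1..<k}. V n j \<le> x \<longleftrightarrow> v j \<le> x) sequentially"
    by (intro eventually_ball_finite) auto
  then have "eventually (\<lambda>n. S n (Suc (count_below k v x)) = step_fun (k, V n, S n) x) sequentially"
  proof eventually_elim
    case (elim n)
    then have "{j \<in> {1..<k}. V n j \<le> x} = {j \<in> {1..<k}. v j \<le> x}" by blast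
    then show ?case using step_fun_eq[OF x k] by (simp add: count_below_def)
  qed
  moreover have "(\<lambda>n. S n (Suc (count_below k v x))) \<longlonglongrightarrow> step_fun (k, v, s) x"
    unfolding step_fun_eq[OF x k] by (rule tendsto_coordinate[OF S])
  ultimately show ?thesis by (rule Lim_transform_eventually[rotated])
qed

lemma AE_unit_neq: "AE x in unit_uniform. x \<noteq> c"
  unfolding unit_uniform_def
  by (subst AE_restrict_space_iff) (use AE_lborel_singleton[of c] in auto)

text \<open>
  The map from parameters to densities is sequentially continuous for the Hellinger distance: the
  integrands converge off the finitely many split points of the limit and are bounded.
\<close>

lemma hellinger_step_tendsto:
  assumes k: "k \<ge> 1" and W: "\<And>n. W n \<in> space (params k)" and w: "w \<in> space (params k)"
    and lim: "W \<longlonglongrightarrow> w"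
  shows "(\<lambda>n. hellinger (step_dens k w) (step_dens k (W n))) \<longlonglongrightarrow> 0"
proof -
  note d = dens_in_densities[OF step_fun_unit_funs]
  let ?G = "\<lambda>n z. (sqrt (step_dens k w z) - sqrt (step_dens k (W n) z))\<^sup>2"
  have Gm: "?G n \<in> borel_measurable base_measure" for n
    using integrable_sqrt_diff(1)[OF d[OF w] d[OF W]] by (rule borel_measurable_integrable)
  have Gb: "\<bar>?G n z\<bar> \<le> 1" if "z \<in> space base_measure" for n z
    using that density_bounds[OF d[OF w] that] density_bounds[OF d[OF W] that]
    by (simp add: sqrt_diff_sq_le)
  have "(\<lambda>n. \<integral>x. ?G n (x, 0) + ?G n (x, 1) \<partial>unit_uniform) \<longlonglongrightarrow> (\<integral>x. 0 \<partial>unit_uniform)"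
  proof (rule integral_dominated_convergence[where w = "\<lambda>_. 2"])
    show "(\<lambda>x. ?G n (x, 0) + ?G n (x, 1)) \<in> borel_measurable unit_uniform" for n
      by (intro borel_measurable_add measurable_base_slice[OF Gm]) auto
    show "AE x in unit_uniform. norm (?G n (x, 0) + ?G n (x, 1)) \<le> 2" for n
    proof (rule AE_I2)
      fix x assume "x \<in> space unit_uniform"
      then have "\<bar>?G n (x, 0)\<bar> \<le> 1" "\<bar>?G n (x, 1)\<bar> \<le> 1" by (intro Gb; simp)+
      then show "norm (?G n (x, 0) + ?G n (x, 1)) \<le> 2" by simp
    qed
    have "AE x in unit_uniform. \<forall>j\<in>{1..<k}. x \<noteq> fst w j"
      by (intro AE_finite_allI AE_unit_neq) auto
    moreover have "AE x in unit_uniform. x \<in> {0..1}" by (rule AE_I2) simp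
    ultimately show "AE x in unit_uniform. (\<lambda>n. ?G n (x, 0) + ?G n (x, 1)) \<longlonglongrightarrow> 0"
    proof eventually_elim
      case (elim x)
      have "(\<lambda>n. step_fun (k, fst (W n), snd (W n)) x) \<longlonglongrightarrow> step_fun (k, fst w, snd w) x"
        using elim by (intro step_fun_tendsto k tendsto_fst tendsto_snd lim) auto
      then have t: "(\<lambda>n. step_fun (k, W n) x) \<longlonglongrightarrow> step_fun (k, w) x" by simp
      have "(\<lambda>n. ?G n (x, 0) + ?G n (x, 1)) \<longlonglongrightarrow>
          (sqrt (1 - step_fun (k, w) x) - sqrt (1 - step_fun (k, w) x))\<^sup>2
        + (sqrt (step_fun (k, w) x) - sqrt (step_fun (k, w) x))\<^sup>2"
        using elim(2) by (simp only: dens_simps)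
          (intro tendsto_add tendsto_power tendsto_diff tendsto_real_sqrt tendsto_const t)
      then show ?case by simp
    qed
  qed (auto intro: integrable_unit_bounded[where C = 2])
  moreover have "(\<integral>x. ?G n (x, 0) + ?G n (x, 1) \<partial>unit_uniform) = (\<integral>z. ?G n z \<partial>base_measure)" for n
    by (rule integral_base_measure[symmetric, OF Gm Gb])
  ultimately have "(\<lambda>n. \<integral>z. ?G n z \<partial>base_measure) \<longlonglongrightarrow> 0" by simp
  from tendsto_real_sqrt[OF this] show ?thesis unfolding hellinger_def by simp
qed

text \<open>
  The product sigma-algebra on the parameters contains the traces of all sets that are open for the
  product topology; coordinates outside the index sets are constantly \<open>undefined\<close>.
\<close>

lemma measurable_params_borel: "(\<lambda>w. w) \<in> borel_measurable (params k)"
proof -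
  have v: "fst \<in> borel_measurable (params k)"
  proof (rule measurable_coordinatewise_then_product)
    show "(\<lambda>w. fst w j) \<in> borel_measurable (params k)" for j
    proof (cases "j \<in> {1..<k}")
      case False
      have "(\<lambda>w. fst w j) \<in> borel_measurable (params k)
        \<longleftrightarrow> (\<lambda>_. undefined :: real) \<in> borel_measurable (params k)"
      proof (rule measurable_cong)
        show "fst w j = undefined" if "w \<in> space (params k)" for w
          using that False PiE_arb[of "fst w" "{1..<k}" "\<lambda>_. {0..1}" j] by (simp add: space_params mem_Times_iff)
      qed
      then show ?thesis by simp
    qed (rule measurable_split_coord)
  qed
  have s: "snd \<in> borel_measurable (params k)"
  proof (rule measurable_coordinatewise_then_product)
    show "(\<lambda>w. snd w j) \<in> borel_measurable (params k)" for j
    proof (cases "j \<in> {1..k}")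
      case False
      have "(\<lambda>w. snd w j) \<in> borel_measurable (params k)
        \<longleftrightarrow> (\<lambda>_. undefined :: real) \<in> borel_measurable (params k)"
      proof (rule measurable_cong)
        show "snd w j = undefined" if "w \<in> space (params k)" for w
          using that False PiE_arb[of "snd w" "{1..k}" "\<lambda>_. {0..1}" j] by (simp add: space_params mem_Times_iff)
      qed
      then show ?thesis by simp
    qed (rule measurable_value_coord)
  qed
  have "(\<lambda>w. (fst w, snd w)) \<in> borel_measurable (params k)"
    by (rule borel_measurable_Pair[OF v s])
  then show ?thesis by simp
qed

text \<open>
  By continuity, the parameters of the densities in a Hellinger open set form a relatively open set of
  parameters.
\<close>

lemma step_dens_measurable_hellinger:
  assumes k: "k \<ge> 1"
  shows "step_dens k \<in> measurable (params k) hellinger_borel"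
  unfolding hellinger_borel_def
proof (rule measurable_measure_of)
  show "step_dens k \<in> space (params k) \<rightarrow> densities"
    by (auto intro!: dens_in_densities step_fun_unit_funs)
  fix U assume U: "U \<in> {U. U \<subseteq> densities \<and>
      (\<forall>f\<in>U. \<exists>e>0. \<forall>g\<in>densities. hellinger f g < e \<longrightarrow> g \<in> U)}"
  let ?P = "space (params k)" and ?E = "step_dens k -` U \<inter> space (params k)"
  have "\<exists>S. open S \<and> w \<in> S \<and> S \<inter> ?P \<subseteq> ?E" if w: "w \<in> ?E" for w
  proof -
    obtain e where e: "e > 0" "\<forall>g\<in>densities. hellinger (step_dens k w) g < e \<longrightarrow> g \<in> U"
      using U w by blast
    have "((\<lambda>w'. hellinger (step_dens k w) (step_dens k w')) \<longlongrightarrow> 0) (at w within ?P)"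
      unfolding tendsto_at_iff_sequentially
    proof safe
      fix X assume X: "\<forall>i. X i \<in> ?P - {w}" "X \<longlonglongrightarrow> w"
      then show "((\<lambda>w'. hellinger (step_dens k w) (step_dens k w')) \<circ> X) \<longlonglongrightarrow> 0"
        unfolding o_def using w by (intro hellinger_step_tendsto k) auto
    qed
    then have "eventually (\<lambda>w'. hellinger (step_dens k w) (step_dens k w') < e) (at w within ?P)"
      using e(1) by (rule order_tendstoD(2))
    then obtain S where S: "open S" "w \<in> S"
      "\<forall>w'\<in>S. w' \<noteq> w \<longrightarrow> w' \<in> ?P \<longrightarrow> hellinger (step_dens k w) (step_dens k w') < e"
      unfolding eventually_at_topological by blast
    have "w' \<in> ?E" if w': "w' \<in> S \<inter> ?P" for w'
    proof (cases "w' = w")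
      case False
      then have "hellinger (step_dens k w) (step_dens k w') < e" using S(3) w' by blast
      then show ?thesis
        using e(2) dens_in_densities[OF step_fun_unit_funs] w' by blast
    qed (use w in simp)
    then show ?thesis using S by blast
  qed
  then obtain S where S: "\<And>w. w \<in> ?E \<Longrightarrow> open (S w) \<and> w \<in> S w \<and> S w \<inter> ?P \<subseteq> ?E"
    by metis
  have E: "?E = (\<lambda>w. w) -` (\<Union>w\<in>?E. S w) \<inter> ?P"
    using S by blast
  have "open (\<Union>w\<in>?E. S w)" using S by blast
  then have "(\<Union>w\<in>?E. S w) \<in> sets borel" by (rule borel_open)
  show "?E \<in> sets (params k)"
    by (subst E) (rule measurable_sets[OF measurable_params_borel \<open>(\<Union>w\<in>?E. S w) \<in> sets borel\<close>])
qed auto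

lemma space_density_algebra [simp]: "space density_algebra = densities"
  unfolding density_algebra_def
proof (rule space_measure_of)
  show "sets hellinger_borel \<union> {{f \<in> densities. f z \<in> A} | z A. z \<in> space base_measure \<and> A \<in> sets borel}
      \<subseteq> Pow densities"
    using sets.sets_into_space[of _ hellinger_borel] by auto
qed

lemma sets_density_algebra:
  "sets density_algebra = sigma_sets densities (sets hellinger_borel \<union>
      {{f \<in> densities. f z \<in> A} | z A. z \<in> space base_measure \<and> A \<in> sets borel})"
  unfolding density_algebra_def
proof (rule sets_measure_of)
  show "sets hellinger_borel \<union> {{f \<in> densities. f z \<in> A} | z A. z \<in> space base_measure \<and> A \<in> sets borel}
      \<subseteq> Pow densities"
    using sets.sets_into_space[of _ hellinger_borel] by auto
qed

lemma hellinger_borel_subset: "A \<in> sets hellinger_borel \<Longrightarrow> A \<in> sets density_algebra"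
  unfolding sets_density_algebra by (rule sigma_sets.Basic) blast

lemma measurable_evaluation:
  assumes "z \<in> space base_measure"
  shows "(\<lambda>f. f z) \<in> borel_measurable density_algebra"
proof (rule measurableI)
  fix A :: "real set" assume "A \<in> sets borel"
  then have "{f \<in> densities. f z \<in> A} \<in> sets density_algebra"
    using assms unfolding sets_density_algebra by (intro sigma_sets.Basic) blast
  moreover have "(\<lambda>f. f z) -` A \<inter> space density_algebra = {f \<in> densities. f z \<in> A}" by auto
  ultimately show "(\<lambda>f. f z) -` A \<inter> space density_algebra \<in> sets density_algebra" by simp
qed simp

lemma measurable_step_dens_eval:
  assumes "z \<in> space base_measure"
  shows "(\<lambda>w. step_dens k w z) \<in> borel_measurable (params k)"
  using assms
proof (cases rule: base_cases)
  case (1 x)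
  then have eq: "step_dens k w z = 1 - step_fun (k, w) x" for w
    by (simp add: dens_simps)
  show ?thesis
    unfolding eq by (intro borel_measurable_diff borel_measurable_const measurable_step_fun_params)
next
  case (2 x)
  then have eq: "step_dens k w z = step_fun (k, w) x" for w
    by (simp add: dens_simps)
  show ?thesis
    unfolding eq by (rule measurable_step_fun_params)
qed

text \<open>
  Both kinds of generators of \<open>density_algebra\<close> have measurable preimages.  With zero pieces the map is
  constant.
\<close>

lemma step_dens_measurable: "step_dens k \<in> measurable (params k) density_algebra"
proof (cases "k \<ge> 1")
  case True
  show ?thesis
    unfolding density_algebra_def
  proof (rule measurable_measure_of)
    show "sets hellinger_borel \<union> {{f \<in> densities. f z \<in> A} | z A. z \<in> space base_measure \<and> A \<in> sets borel}
      \<subseteq> Pow densities"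
      using sets.sets_into_space[of _ hellinger_borel] by auto
    show sp: "step_dens k \<in> space (params k) \<rightarrow> densities"
      by (auto intro!: dens_in_densities step_fun_unit_funs)
    fix B assume "B \<in> sets hellinger_borel \<union>
      {{f \<in> densities. f z \<in> A} | z A. z \<in> space base_measure \<and> A \<in> sets borel}"
    then consider "B \<in> sets hellinger_borel"
      | z A where "z \<in> space base_measure" "A \<in> sets borel" "B = {f \<in> densities. f z \<in> A}"
      by blast
    then show "step_dens k -` B \<inter> space (params k) \<in> sets (params k)"
    proof cases
      case 1
      then show ?thesis by (rule measurable_sets[OF step_dens_measurable_hellinger[OF True]])
    next
      case 2
      have "step_dens k -` B \<inter> space (params k) = (\<lambda>w. step_dens k w z) -` A \<inter> space (params k)"
        using sp 2(3) by auto
      then show ?thesis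
        using measurable_sets[OF measurable_step_dens_eval[OF 2(1)] 2(2)] by simp
    qed
  qed
next
  case False
  then have k: "k = 0" by simp
  have "step_dens 0 = (\<lambda>w. dens (restrict (\<lambda>x. 0) {0..1}))"
    by (rule ext) (auto simp: step_fun_zero split: prod.splits)
  moreover have "dens (restrict (\<lambda>x. 0) {0..1}) \<in> space density_algebra"
    using dens_in_densities[OF step_fun_unit_funs, of "(\<lambda>_. undefined, \<lambda>_. undefined)" 0]
    by (simp add: space_params step_fun_zero)
  ultimately show ?thesis unfolding k by (simp only: measurable_const)
qed

lemma prior_eq: "prior \<kappa> = measure_pmf \<kappa> \<bind> (\<lambda>k. distr (params k) density_algebra (step_dens k))"
  unfolding prior_def params_def by (simp add: split_beta')

lemma prior_kernel:
  "(\<lambda>k. distr (params k) density_algebra (step_dens k))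
     \<in> measurable (measure_pmf \<kappa>) (subprob_algebra density_algebra)"
proof -
  have "distr (params k) density_algebra (step_dens k) \<in> space (subprob_algebra density_algebra)" for k
    using prob_space.prob_space_distr[OF prob_space_params step_dens_measurable]
    by (simp add: space_subprob_algebra prob_space_imp_subprob_space)
  then show ?thesis by simp
qed

lemma sets_prior: "sets (prior \<kappa>) = sets density_algebra"
  unfolding prior_eq by (rule sets_bind) auto

lemma space_prior [simp]: "space (prior \<kappa>) = densities"
  using sets_eq_imp_space_eq[OF sets_prior] by simp

text \<open>
  The form in which the prior is used: a mixture over the number of pieces of integrals over parameters.
\<close>

lemma nn_integral_prior:
  assumes "h \<in> borel_measurable density_algebra"
  shows "(\<integral>\<^sup>+f. h f \<partial>prior \<kappa>)
    = (\<Sum>k. ennreal (pmf \<kappa> k) * (\<integral>\<^sup>+w. h (step_dens k w) \<partial>params k))"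
proof -
  have "(\<integral>\<^sup>+f. h f \<partial>prior \<kappa>)
      = (\<integral>\<^sup>+k. \<integral>\<^sup>+f. h f \<partial>distr (params k) density_algebra (step_dens k) \<partial>measure_pmf \<kappa>)"
    unfolding prior_eq by (rule nn_integral_bind[OF assms prior_kernel])
  also have "\<dots> = (\<integral>\<^sup>+k. \<integral>\<^sup>+w. h (step_dens k w) \<partial>params k \<partial>measure_pmf \<kappa>)"
    by (intro nn_integral_cong nn_integral_distr step_dens_measurable) (simp add: assms)
  finally show ?thesis
    by (simp add: nn_integral_measure_pmf nn_integral_count_space_nat)
qed

lemma prob_space_prior: "prob_space (prior \<kappa>)"
proof -
  have "emeasure (prior \<kappa>) (space (prior \<kappa>)) = (\<integral>\<^sup>+f. 1 \<partial>prior \<kappa>)" by simp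
  also have "\<dots> = (\<Sum>k. ennreal (pmf \<kappa> k))"
    by (subst nn_integral_prior) (simp_all add: prob_space.emeasure_space_1[OF prob_space_params])
  also have "\<dots> = (\<integral>\<^sup>+k. 1 \<partial>measure_pmf \<kappa>)"
    by (simp add: nn_integral_measure_pmf nn_integral_count_space_nat del: nn_integral_const)
  finally show ?thesis by (intro prob_spaceI) simp
qed

section \<open>Finitely many majorants for the step functions with k pieces\<close>

text \<open>
  The index of the cell \<open>{c / m ..< (c + 1) / m}\<close> that contains \<open>x\<close>.  The point \<open>1\<close> has a cell of its
  own, with index \<open>m\<close>.
\<close>

definition cell :: "nat \<Rightarrow> real \<Rightarrow> nat" where
  "cell m x = nat \<lfloor>real m * x\<rfloor>"

text \<open>
  The entry \<open>j\<close> for a cell and a label stands for the value \<open>j / L\<close>; natural numbers make the set of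
  tables finite.
\<close>

definition tables :: "nat \<Rightarrow> nat \<Rightarrow> (nat \<times> nat \<Rightarrow> nat) set" where
  "tables m L = ({0..m} \<times> {0, 1}) \<rightarrow>\<^sub>E {0..L}"

definition table_fun :: "nat \<Rightarrow> nat \<Rightarrow> (nat \<times> nat \<Rightarrow> nat) \<Rightarrow> real \<times> nat \<Rightarrow> real" where
  "table_fun m L t = (\<lambda>(x, y). real (t (cell m x, y)) / real L)"

lemma finite_tables: "finite (tables m L)"
  unfolding tables_def by (intro finite_PiE) auto

lemma card_tables: "card (tables m L) = Suc L ^ (2 * Suc m)"
  unfolding tables_def by (subst card_PiE) (auto simp: card_cartesian_product mult_2)

lemma cell_le: "x \<in> {0..1} \<Longrightarrow> cell m x \<le> m"
  unfolding cell_def by (simp add: nat_le_iff floor_le_iff) (smt (verit) mult_left_le of_nat_0_le_iff)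

lemma cell_bounds:
  assumes "0 \<le> x" shows "real (cell m x) \<le> real m * x" "real m * x < real (cell m x) + 1"
  using assms unfolding cell_def by (simp_all add: of_nat_nat floor_correct)

lemma measurable_cell: "cell m \<in> measurable borel (count_space UNIV)"
proof -
  have "(\<lambda>x. real m * x) \<in> borel_measurable borel"
    by (intro borel_measurable_times borel_measurable_const measurable_ident_sets refl)
  from measurable_compose[OF measurable_compose[OF this measurable_real_floor], of nat "count_space UNIV"]
  show ?thesis unfolding cell_def by simp
qed

lemma table_fun_measurable: "table_fun m L t \<in> borel_measurable base_measure"
proof (rule measurable_baseI)
  have "(\<lambda>x. table_fun m L t (x, y)) \<in> borel_measurable borel" for y
    unfolding table_fun_def prod.case
    by (rule measurable_compose[OF measurable_cell]) simp
  then show "(\<lambda>x. table_fun m L t (x, 0)) \<in> borel_measurable unit_uniform"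
    "(\<lambda>x. table_fun m L t (x, 1)) \<in> borel_measurable unit_uniform"
    by (auto intro: borel_imp_unit_measurable)
qed

lemma table_fun_bounds:
  assumes "t \<in> tables m L" "z \<in> space base_measure" "L \<ge> 1"
  shows "0 \<le> table_fun m L t z" "table_fun m L t z \<le> 1"
proof -
  obtain x y where z: "z = (x, y)" "x \<in> {0..1}" "y \<in> {0, 1}" using assms(2) by auto
  have "t (cell m x, y) \<in> {0..L}"
    using assms(1) unfolding tables_def by (rule PiE_mem) (use z cell_le in auto)
  then show "0 \<le> table_fun m L t z" "table_fun m L t z \<le> 1"
    using assms(3) by (auto simp: table_fun_def z)
qed

lemma cell_integral:
  assumes "m \<ge> 1"
  shows "integrable unit_uniform (\<lambda>x. of_bool (cell m x = c) :: real)"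
    and "(\<integral>x. of_bool (cell m x = c) \<partial>unit_uniform) \<le> 1 / real m"
proof -
  let ?S = "{real c / m .. (real c + 1) / m}"
  have "(\<lambda>x. of_bool (cell m x = c) :: real) \<in> borel_measurable borel"
    by (rule measurable_compose[OF measurable_cell]) simp
  then show int: "integrable unit_uniform (\<lambda>x. of_bool (cell m x = c) :: real)"
    by (intro integrable_unit_bounded[where C = 1] borel_imp_unit_measurable) auto
  have "(\<lambda>x. indicator ?S x :: real) \<in> borel_measurable borel"
    by (intro borel_measurable_indicator borel_closed closed_atLeastAtMost)
  then have int2: "integrable unit_uniform (\<lambda>x. indicator ?S x :: real)"
    by (intro integrable_unit_bounded[where C = 1] borel_imp_unit_measurable) auto
  have "(\<integral>x. of_bool (cell m x = c) \<partial>unit_uniform) \<le> (\<integral>x. (indicator ?S x :: real) \<partial>unit_uniform)"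
  proof (rule integral_mono[OF int int2])
    fix x assume "x \<in> space unit_uniform"
    then have "0 \<le> x" by simp
    from cell_bounds[OF this, of m] show "of_bool (cell m x = c) \<le> (indicator ?S x :: real)"
      using assms by (auto simp: indicator_def field_simps)
  qed
  also have "\<dots> = measure unit_uniform (?S \<inter> space unit_uniform)" by simp
  also have "\<dots> \<le> 1 / real m"
  proof -
    have "emeasure unit_uniform (?S \<inter> {0..1}) = emeasure lborel (?S \<inter> {0..1})"
      unfolding unit_uniform_def by (rule emeasure_restrict_space) auto
    also have "\<dots> \<le> emeasure lborel ?S"
      by (rule emeasure_mono) auto
    also have "\<dots> = ennreal (1 / real m)"
      using assms by (subst emeasure_lborel_Icc) (auto simp: field_simps)
    finally show ?thesis
      by (simp add: measure_def enn2real_leI)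
  qed
  finally show "(\<integral>x. of_bool (cell m x = c) \<partial>unit_uniform) \<le> 1 / real m" .
qed

text \<open>
  On a cell without split points the step function is constant, and rounding its density up to a
  multiple of \<open>1 / L\<close> adds at most \<open>1 / L\<close>.  On the at most \<open>k - 1\<close> cells with split points the
  majorant is \<open>1\<close>; each of these has probability at most \<open>1 / m\<close>.  The factors \<open>2\<close> come from the two labels.
\<close>

lemma step_dens_cover:
  assumes w: "w \<in> space (params k)" and k: "k \<ge> 1" and m: "m \<ge> 1" and L: "L \<ge> 1"
  obtains t where "t \<in> tables m L"
    "\<And>z. z \<in> space base_measure \<Longrightarrow> step_dens k w z \<le> table_fun m L t z"
    "(\<integral>z. table_fun m L t z - step_dens k w z \<partial>base_measure) \<le> 2 / L + 2 * (real k - 1) / m"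
proof -
  obtain v s where ws: "w = (v, s)" by (cases w)
  have v: "0 \<le> v j" if "j \<in> {1..<k}" for j
    using w that unfolding ws by (auto simp: space_params PiE_iff)
  note fu = step_fun_unit_funs[OF w]
  define bad where "bad c \<longleftrightarrow> (\<exists>j\<in>{1..<k}. cell m (v j) = c)" for c
  define t where "t = (\<lambda>(c, y)\<in>{0..m} \<times> {0, 1}.
      if bad c then L else nat \<lceil>real L * step_dens k w (real c / m, y)\<rceil>)"
  have cm: "real c / real m \<in> {0..1}" if "c \<le> m" for c
    using that m by simp
  have tt: "t \<in> tables m L"
    unfolding tables_def
  proof (rule PiE_I)
    fix p assume "p \<in> {0..m} \<times> {0, 1 :: nat}"
    then obtain c y where p: "p = (c, y)" "c \<le> m" "y \<in> {0, 1}" by auto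
    then have "step_dens k w (real c / m, y) \<le> 1"
      using cm[OF p(2)] by (intro dens_bounds[OF fu]) auto
    then have "real L * step_dens k w (real c / m, y) \<le> real L"
      by (simp add: mult_left_le)
    then have "\<lceil>real L * step_dens k w (real c / m, y)\<rceil> \<le> int L"
      by (simp only: ceiling_le_iff of_int_of_nat_eq)
    then have "nat \<lceil>real L * step_dens k w (real c / m, y)\<rceil> \<le> L" by (simp only: nat_le_iff)
    then show "t p \<in> {0..L}" using p(2,3) unfolding p(1) t_def by simp
  qed (simp add: t_def)
  have key: "step_dens k w (x, y) \<le> table_fun m L t (x, y) \<and>
      table_fun m L t (x, y) \<le> step_dens k w (x, y) + (1 / L + (\<Sum>j\<in>{1..<k}. of_bool (cell m x = cell m (v j))))"
    if x: "x \<in> {0..1}" and y: "y \<in> {0, 1}" for x y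
  proof (cases "bad (cell m x)")
    case True
    have z: "(x, y) \<in> space base_measure" using x y by simp
    obtain j where j: "j \<in> {1..<k}" "cell m (v j) = cell m x" using True by (auto simp: bad_def)
    have "1 \<le> (\<Sum>j\<in>{1..<k}. of_bool (cell m x = cell m (v j)) :: real)"
      using member_le_sum[of j "{1..<k}" "\<lambda>j. of_bool (cell m x = cell m (v j)) :: real"] j by auto
    moreover have "table_fun m L t (x, y) = 1"
      using True L cell_le[OF x] y by (auto simp: table_fun_def t_def)
    ultimately show ?thesis using dens_bounds[OF fu z] by (simp add: add_increasing)
  next
    case False
    let ?c = "cell m x"
    have z: "(real ?c / m, y) \<in> space base_measure" using cm[OF cell_le[OF x]] y by simp
    let ?a = "step_dens k w (real ?c / m, y)"
    have x0: "0 \<le> x" using x by simp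
    have "v j \<le> x \<longleftrightarrow> v j \<le> real ?c / m" if j: "j \<in> {1..<k}" for j
    proof
      assume le: "v j \<le> x"
      have "cell m (v j) \<le> ?c" unfolding cell_def
        using le m by (intro nat_mono floor_mono mult_left_mono) auto
      moreover have "cell m (v j) \<noteq> ?c" using False j by (auto simp: bad_def)
      ultimately have "real (cell m (v j)) + 1 \<le> real ?c" by linarith
      then have "real m * v j \<le> real ?c" using cell_bounds[OF v[OF j], of m] by linarith
      then show "v j \<le> real ?c / m" using m by (simp add: field_simps)
    next
      assume "v j \<le> real ?c / m"
      also have "\<dots> \<le> x" using cell_bounds[OF x0, of m] m by (simp add: field_simps)
      finally show "v j \<le> x" .
    qed
    then have "{j \<in> {1..<k}. v j \<le> x} = {j \<in> {1..<k}. v j \<le> real ?c / m}" by blast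
    then have "step_fun (k, w) x = step_fun (k, w) (real ?c / m)"
      using step_fun_eq[OF x k] step_fun_eq[OF cm[OF cell_le[OF x]] k]
      by (simp add: ws count_below_def)
    then have a: "step_dens k w (x, y) = ?a"
      using x y cm[OF cell_le[OF x]] by (auto simp: dens_simps)
    have La: "0 \<le> real L * ?a" using dens_bounds[OF fu z] by simp
    have "table_fun m L t (x, y) = real (nat \<lceil>real L * ?a\<rceil>) / L"
      using False cell_le[OF x] y by (simp add: table_fun_def t_def)
    also have "\<dots> = real_of_int \<lceil>real L * ?a\<rceil> / L"
      using La by simp
    finally have eq: "table_fun m L t (x, y) = real_of_int \<lceil>real L * ?a\<rceil> / L" .
    have "real L * ?a \<le> real_of_int \<lceil>real L * ?a\<rceil>" "real_of_int \<lceil>real L * ?a\<rceil> \<le> real L * ?a + 1"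
      by linarith+
    then have "?a \<le> table_fun m L t (x, y)" "table_fun m L t (x, y) \<le> ?a + 1 / L"
      using L unfolding eq by (simp_all add: field_simps)
    moreover have "0 \<le> (\<Sum>j\<in>{1..<k}. of_bool (cell m x = cell m (v j)) :: real)"
      by (intro sum_nonneg) simp
    ultimately show ?thesis unfolding a by linarith
  qed
  have meas: "(\<lambda>z. table_fun m L t z - step_dens k w z) \<in> borel_measurable base_measure"
    by (intro borel_measurable_diff table_fun_measurable dens_measurable fu)
  have bd: "\<bar>table_fun m L t z - step_dens k w z\<bar> \<le> 1" if "z \<in> space base_measure" for z
    using dens_bounds[OF fu that] table_fun_bounds[OF tt that L] by linarith
  have "(\<integral>z. table_fun m L t z - step_dens k w z \<partial>base_measure)
    = (\<integral>x. (table_fun m L t (x, 0) - step_dens k w (x, 0)) +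
           (table_fun m L t (x, 1) - step_dens k w (x, 1)) \<partial>unit_uniform)"
    by (rule integral_base_measure[OF meas bd])
  also have "\<dots> \<le> (\<integral>x. 2 * (1 / L + (\<Sum>j\<in>{1..<k}. of_bool (cell m x = cell m (v j)))) \<partial>unit_uniform)"
  proof (rule integral_mono)
    show "integrable unit_uniform (\<lambda>x. (table_fun m L t (x, 0) - step_dens k w (x, 0)) +
           (table_fun m L t (x, 1) - step_dens k w (x, 1)))"
    proof (rule integrable_unit_bounded[where C = 2])
      show "(\<lambda>x. (table_fun m L t (x, 0) - step_dens k w (x, 0)) +
           (table_fun m L t (x, 1) - step_dens k w (x, 1))) \<in> borel_measurable unit_uniform"
        by (rule borel_measurable_add[OF measurable_base_slice[OF meas] measurable_base_slice[OF meas]]) auto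
      fix x :: real assume "x \<in> {0..1}"
      then show "\<bar>(table_fun m L t (x, 0) - step_dens k w (x, 0)) +
           (table_fun m L t (x, 1) - step_dens k w (x, 1))\<bar> \<le> 2"
        using bd[of "(x, 0)"] bd[of "(x, 1)"] by simp
    qed
    show "integrable unit_uniform (\<lambda>x. 2 * (1 / L + (\<Sum>j\<in>{1..<k}. of_bool (cell m x = cell m (v j)))))"
      by (intro integrable_mult_right Bochner_Integration.integrable_add Bochner_Integration.integrable_sum
            cell_integral m integrable_unit_bounded[where C = "1 / L"]) auto
    fix x assume "x \<in> space unit_uniform"
    then have x: "x \<in> {0..1}" by simp
    show "(table_fun m L t (x, 0) - step_dens k w (x, 0)) + (table_fun m L t (x, 1) - step_dens k w (x, 1))
      \<le> 2 * (1 / L + (\<Sum>j\<in>{1..<k}. of_bool (cell m x = cell m (v j))))"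
      using key[OF x, of 0] key[OF x, of 1] by simp
  qed
  also have "\<dots> = 2 * (1 / L + (\<Sum>j\<in>{1..<k}. \<integral>x. of_bool (cell m x = cell m (v j)) \<partial>unit_uniform))"
  proof -
    have "integrable unit_uniform (\<lambda>_. 1 / real L)"
      by (rule integrable_unit_bounded[where C = "1 / L"]) auto
    moreover have "(\<integral>_. 1 / real L \<partial>unit_uniform) = 1 / L"
      using prob_space.prob_space[OF prob_space_unit_uniform] by simp
    ultimately show ?thesis
      by (simp only: integral_mult_right_zero Bochner_Integration.integral_add
          Bochner_Integration.integral_sum Bochner_Integration.integrable_sum cell_integral(1)[OF m])
  qed
  also have "\<dots> \<le> 2 * (1 / L + (\<Sum>j\<in>{1..<k}. 1 / real m))"
    by (intro mult_left_mono add_left_mono sum_mono cell_integral(2) m) auto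
  also have "\<dots> = 2 / L + 2 * (real k - 1) / m"
    using k by (simp add: of_nat_diff algebra_simps add_divide_distrib)
  finally have "(\<integral>z. table_fun m L t z - step_dens k w z \<partial>base_measure) \<le> 2 / L + 2 * (real k - 1) / m" .
  moreover have "step_dens k w z \<le> table_fun m L t z" if "z \<in> space base_measure" for z
    using key that by auto
  ultimately show ?thesis using tt that by blast
qed

text \<open>
  A majorant \<open>u\<close> of a density \<open>f\<close> far from \<open>g\<close> has affinity with \<open>g\<close> bounded away from \<open>1\<close>, provided
  \<open>u - f\<close> has small integral: \<open>sqrt (u * g) \<le> sqrt (f * g) + sqrt ((u - f) * g)\<close>, the first term integrates to
  \<open>1\<close> minus half the squared Hellinger distance, and the second is at most
  \<open>\<delta> * g / 2 + (u - f) / (2 * \<delta>)\<close>.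
\<close>

lemma affinity_bound:
  assumes f: "f \<in> densities" and g: "g \<in> densities"
    and u: "u \<in> borel_measurable base_measure" "\<And>z. z \<in> space base_measure \<Longrightarrow> f z \<le> u z"
      "\<And>z. z \<in> space base_measure \<Longrightarrow> u z \<le> 1"
    and e: "\<epsilon> \<ge> 0" "hellinger g f > \<epsilon>" and l: "\<delta> > 0"
    and tau: "(\<integral>z. u z - f z \<partial>base_measure) \<le> \<tau>"
  shows "(\<integral>z. sqrt (u z * g z) \<partial>base_measure) \<le> 1 - \<epsilon>\<^sup>2 / 2 + \<delta> / 2 + \<tau> / (2 * \<delta>)"
proof -
  note fb = density_bounds[OF f] and gb = density_bounds[OF g]
  let ?r = "\<lambda>z. (f z + g z - (sqrt (g z) - sqrt (f z))\<^sup>2) / 2 + (\<delta> * g z / 2 + (u z - f z) / (2 * \<delta>))"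
  have int_uf: "integrable base_measure (\<lambda>z. u z - f z)"
  proof (rule integrable_base_bounded[where C = 1])
    show "(\<lambda>z. u z - f z) \<in> borel_measurable base_measure"
      by (intro borel_measurable_diff u density_measurable f)
    show "\<bar>u z - f z\<bar> \<le> 1" if "z \<in> space base_measure" for z
      using u(2)[OF that] u(3)[OF that] fb[OF that] by linarith
  qed
  note ints = int_uf integrable_density[OF f] integrable_density[OF g] integrable_sqrt_diff(1)[OF g f]
  have "(\<integral>z. sqrt (u z * g z) \<partial>base_measure) \<le> (\<integral>z. ?r z \<partial>base_measure)"
  proof (rule integral_mono)
    show "integrable base_measure (\<lambda>z. sqrt (u z * g z))"
    proof (rule integrable_base_bounded[where C = 1])
      show "(\<lambda>z. sqrt (u z * g z)) \<in> borel_measurable base_measure"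
        by (intro measurable_compose[OF _ borel_measurable_sqrt] borel_measurable_times u density_measurable g)
      show "\<bar>sqrt (u z * g z)\<bar> \<le> 1" if "z \<in> space base_measure" for z
        using u(2)[OF that] u(3)[OF that] fb[OF that] gb[OF that] by (simp add: mult_le_one)
    qed
    show "integrable base_measure ?r"
      by (intro Bochner_Integration.integrable_add Bochner_Integration.integrable_diff
            integrable_divide integrable_mult_right ints)
    fix z assume z: "z \<in> space base_measure"
    define a b d where "a = sqrt (f z)" and "b = sqrt (g z)" and "d = sqrt (u z - f z)"
    have sq: "f z = a\<^sup>2" "g z = b\<^sup>2" "u z - f z = d\<^sup>2" "0 \<le> a" "0 \<le> b" "0 \<le> d"
      using fb[OF z] gb[OF z] u(2)[OF z] by (simp_all add: a_def b_def d_def)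
    have "u z = a\<^sup>2 + d\<^sup>2" using sq by linarith
    then have "sqrt (u z * g z) = sqrt (a\<^sup>2 + d\<^sup>2) * b"
      using sq by (simp add: real_sqrt_mult)
    also have "\<dots> \<le> (a + d) * b"
      using sq sqrt_add_le_add_sqrt[of "a\<^sup>2" "d\<^sup>2"] by (intro mult_right_mono) simp_all
    also have "\<dots> = a * b + d * b" by (simp add: algebra_simps)
    also have "d * b \<le> \<delta> * b\<^sup>2 / 2 + d\<^sup>2 / (2 * \<delta>)"
    proof -
      have "0 \<le> (\<delta> * b - d)\<^sup>2" by simp
      then have "2 * \<delta> * (d * b) \<le> \<delta>\<^sup>2 * b\<^sup>2 + d\<^sup>2"
        by (simp add: power2_diff power_mult_distrib algebra_simps)
      then have "d * b \<le> (\<delta>\<^sup>2 * b\<^sup>2 + d\<^sup>2) / (2 * \<delta>)"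
        using l by (simp add: field_simps)
      also have "\<dots> = \<delta> * b\<^sup>2 / 2 + d\<^sup>2 / (2 * \<delta>)"
        using l by (simp add: field_simps power2_eq_square)
      finally show ?thesis .
    qed
    also have "a * b = (a\<^sup>2 + b\<^sup>2 - (b - a)\<^sup>2) / 2"
      by (simp add: power2_diff)
    finally show "sqrt (u z * g z) \<le> ?r z"
      using sq by (simp add: a_def[symmetric] b_def[symmetric])
  qed
  also have "\<dots> = (1 + 1 - (hellinger g f)\<^sup>2) / 2 + (\<delta> / 2 + (\<integral>z. u z - f z \<partial>base_measure) / (2 * \<delta>))"
    using ints by (simp add: hellinger_sq integral_density f g)
  also have "\<dots> \<le> (1 + 1 - \<epsilon>\<^sup>2) / 2 + (\<delta> / 2 + \<tau> / (2 * \<delta>))"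
  proof -
    have "\<epsilon>\<^sup>2 \<le> (hellinger g f)\<^sup>2" using e by (intro power_mono) auto
    moreover have "(\<integral>z. u z - f z \<partial>base_measure) / (2 * \<delta>) \<le> \<tau> / (2 * \<delta>)"
      using tau l by (intro divide_right_mono) auto
    ultimately show ?thesis by argo
  qed
  finally show ?thesis by argo
qed

text \<open>
  With \<open>L * k\<close> cells, both the precision of the majorants and the bound \<open>\<rho>\<close> are independent of \<open>k\<close>, while
  the number of tables grows only exponentially in \<open>k\<close>.
\<close>

lemma far_step_dens_cover:
  assumes f0: "f0 \<in> unit_funs" and \<epsilon>: "\<epsilon> > 0"
  obtains \<rho> C :: real and U :: "nat \<Rightarrow> (real \<times> nat \<Rightarrow> real) set"
  where "0 < \<rho>" "\<rho> < 1" "C \<ge> 1"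
    "\<forall>k. finite (U k)" "\<forall>k\<ge>1. real (card (U k)) \<le> C ^ k"
    "\<forall>k. \<forall>u\<in>U k. u \<in> borel_measurable base_measure"
    "\<forall>k. \<forall>u\<in>U k. \<forall>z\<in>space base_measure. 0 \<le> u z \<and> u z \<le> 1"
    "\<forall>k. \<forall>u\<in>U k. (\<integral>z. sqrt (u z * dens f0 z) \<partial>base_measure) \<le> \<rho>"
    "\<forall>k\<ge>1. \<forall>w\<in>space (params k). hellinger (dens f0) (step_dens k w) > \<epsilon> \<longrightarrow>
       (\<exists>u\<in>U k. \<forall>z\<in>space base_measure. step_dens k w z \<le> u z)"
proof -
  \<comment> \<open>with excess at most \<open>\<delta>\<^sup>2\<close>, the bound in \<open>affinity_bound\<close> becomes \<open>1 - 2 * \<delta> + \<delta> / 2 + \<delta> / 2 = 1 - \<delta>\<close>\<close>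
  define \<delta> where "\<delta> = \<epsilon>\<^sup>2 / 4"
  have l: "\<delta> > 0" using \<epsilon> by (simp add: \<delta>_def)
  obtain L :: nat where L: "real L > 4 / \<delta>\<^sup>2" using reals_Archimedean2 by blast
  have "0 < 4 / \<delta>\<^sup>2" using l by simp
  then have L1: "L \<ge> 1" using L by (cases L) auto
  have L4: "4 / real L \<le> \<delta>\<^sup>2" using L L1 l by (simp add: field_simps)
  \<comment> \<open>the exponential keeps \<open>\<rho>\<close> positive also for large \<open>\<epsilon>\<close>\<close>
  define \<rho> where "\<rho> = exp (- \<delta>)"
  define U where "U k = {u \<in> table_fun (L * k) L ` tables (L * k) L.
      (\<integral>z. sqrt (u z * dens f0 z) \<partial>base_measure) \<le> \<rho>}" for k
  define C where "C = real (Suc L ^ (2 * Suc L))"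
  show thesis
  proof (rule that; (intro allI ballI impI)?)
    show "0 < \<rho>" "\<rho> < 1" using l by (auto simp: \<rho>_def)
    have "1 \<le> Suc L ^ (2 * Suc L)" by (rule one_le_power) simp
    then have "real 1 \<le> C" unfolding C_def by (rule of_nat_mono)
    then show "C \<ge> 1" by (simp only: of_nat_1)
    show fin: "finite (U k)" for k by (simp add: U_def finite_tables)
    show "real (card (U k)) \<le> C ^ k" if k: "k \<ge> 1" for k
    proof -
      have "card (U k) \<le> card (table_fun (L * k) L ` tables (L * k) L)"
        unfolding U_def by (intro card_mono) (auto simp: finite_tables)
      also have "\<dots> \<le> card (tables (L * k) L)" by (rule card_image_le[OF finite_tables])
      also have "\<dots> = Suc L ^ (2 * Suc (L * k))" by (rule card_tables)
      also have "\<dots> \<le> Suc L ^ (2 * Suc L * k)"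
        using k by (intro power_increasing) auto
      finally have "real (card (U k)) \<le> real (Suc L ^ (2 * Suc L * k))" by (rule of_nat_mono)
      then show ?thesis by (simp only: C_def power_mult of_nat_power)
    qed
    show "u \<in> borel_measurable base_measure" if "u \<in> U k" for k u
      using that table_fun_measurable by (auto simp: U_def)
    show "0 \<le> u z \<and> u z \<le> 1" if "u \<in> U k" "z \<in> space base_measure" for k u z
      using that table_fun_bounds[OF _ that(2) L1] by (auto simp: U_def simp del: space_base_measure)
    show "(\<integral>z. sqrt (u z * dens f0 z) \<partial>base_measure) \<le> \<rho>" if "u \<in> U k" for k u
      using that by (simp add: U_def)
    show "\<exists>u\<in>U k. \<forall>z\<in>space base_measure. step_dens k w z \<le> u z"
      if k: "k \<ge> 1" and w: "w \<in> space (params k)"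
        and h: "hellinger (dens f0) (step_dens k w) > \<epsilon>" for k w
    proof -
      have m: "L * k \<ge> 1" using k L1 by simp
      obtain t where t: "t \<in> tables (L * k) L"
        "\<And>z. z \<in> space base_measure \<Longrightarrow> step_dens k w z \<le> table_fun (L * k) L t z"
        "(\<integral>z. table_fun (L * k) L t z - step_dens k w z \<partial>base_measure)
          \<le> 2 / L + 2 * (real k - 1) / real (L * k)"
        using step_dens_cover[OF w k m L1] by blast
      have "2 * (real k - 1) / real (L * k) \<le> 2 * real k / real (L * k)"
        by (intro divide_right_mono) auto
      also have "\<dots> = 2 / L" using k by simp
      finally have "2 / L + 2 * (real k - 1) / real (L * k) \<le> 4 / L" by simp
      with t(3) L4 have tau: "(\<integral>z. table_fun (L * k) L t z - step_dens k w z \<partial>base_measure) \<le> \<delta>\<^sup>2"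
        by linarith
      have "(\<integral>z. sqrt (table_fun (L * k) L t z * dens f0 z) \<partial>base_measure)
          \<le> 1 - \<epsilon>\<^sup>2 / 2 + \<delta> / 2 + \<delta>\<^sup>2 / (2 * \<delta>)"
        using \<epsilon> by (intro affinity_bound[OF dens_in_densities[OF step_fun_unit_funs[OF w]]
              dens_in_densities[OF f0] table_fun_measurable t(2) table_fun_bounds(2)[OF t(1) _ L1] _ h l tau]) auto
      also have "\<dots> = 1 + (- \<delta>)" using l by (simp add: \<delta>_def power2_eq_square field_simps)
      also have "\<dots> \<le> \<rho>" unfolding \<rho>_def by (rule exp_ge_add_one_self)
      finally show ?thesis using t by (intro bexI[of _ "table_fun (L * k) L t"]) (auto simp: U_def)
    qed
  qed
qed

section \<open>Products over independent observations\<close>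

lemma measurable_coord_comp:
  assumes "g \<in> measurable D N" "i \<in> I"
  shows "(\<lambda>z. g (z i)) \<in> measurable (\<Pi>\<^sub>M i\<in>I. D) N"
  using measurable_component_singleton[OF assms(2), of "\<lambda>_. D"] assms(1) by (rule measurable_compose)

lemma nn_integral_PiM_prod:
  fixes \<phi> :: "'a \<Rightarrow> ennreal"
  assumes D: "prob_space D" and \<phi>: "\<phi> \<in> borel_measurable D"
  shows "(\<integral>\<^sup>+z. (\<Prod>i<n. \<phi> (z i)) \<partial>(\<Pi>\<^sub>M i\<in>(UNIV :: nat set). D)) = (\<integral>\<^sup>+y. \<phi> y \<partial>D) ^ n"
proof -
  interpret product_prob_space "\<lambda>_. D" "UNIV :: nat set"
    by (intro product_prob_spaceI D)
  have m: "(\<lambda>z. \<Prod>i<n. \<phi> (z i)) \<in> borel_measurable (\<Pi>\<^sub>M i\<in>{..<n}. D)"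
    by (intro borel_measurable_prod_ennreal measurable_coord_comp \<phi>)
  have "(\<integral>\<^sup>+z. (\<Prod>i<n. \<phi> (z i)) \<partial>(\<Pi>\<^sub>M i\<in>UNIV. D))
      = (\<integral>\<^sup>+z. (\<Prod>i<n. \<phi> (restrict z {..<n} i)) \<partial>(\<Pi>\<^sub>M i\<in>UNIV. D))"
    by (intro nn_integral_cong prod.cong) auto
  also have "\<dots> = (\<integral>\<^sup>+z. (\<Prod>i<n. \<phi> (z i)) \<partial>distr (\<Pi>\<^sub>M i\<in>UNIV. D) (\<Pi>\<^sub>M i\<in>{..<n}. D) (\<lambda>z. restrict z {..<n}))"
    using m by (intro nn_integral_distr[symmetric] measurable_restrict_subset) simp_all
  also have "\<dots> = (\<integral>\<^sup>+z. (\<Prod>i<n. \<phi> (z i)) \<partial>(\<Pi>\<^sub>M i\<in>{..<n}. D))"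
    by (subst distr_PiM_restrict_finite) auto
  also have "\<dots> = (\<integral>\<^sup>+y. \<phi> y \<partial>D) ^ n"
    by (subst product_nn_integral_prod) (auto simp: \<phi>)
  finally show ?thesis .
qed

text \<open>
  Markov's inequality bounds the probability that \<open>W n\<close> exceeds \<open>b ^ n\<close> by a multiple of \<open>(a / b) ^ n\<close>,
  which is summable.
\<close>

lemma AE_eventually_le_geometric:
  fixes W :: "nat \<Rightarrow> 'a \<Rightarrow> ennreal"
  assumes W: "\<And>n. W n \<in> borel_measurable M"
    and bound: "\<And>n. (\<integral>\<^sup>+z. W n z \<partial>M) \<le> ennreal (K * a ^ n)"
    and ab: "0 \<le> K" "0 \<le> a" "a < b"
  shows "AE z in M. eventually (\<lambda>n. W n z \<le> ennreal (b ^ n)) sequentially"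
proof -
  have b: "b > 0" using ab by linarith
  define A where "A n = {z \<in> space M. 1 \<le> ennreal (1 / b ^ n) * W n z}" for n
  have A: "A n \<in> sets M" for n
  proof -
    have "(\<lambda>z. ennreal (1 / b ^ n) * W n z) \<in> borel_measurable M"
      by (intro borel_measurable_times_ennreal borel_measurable_const W)
    then show ?thesis
      unfolding A_def by (intro borel_measurable_le borel_measurable_const)
  qed
  have em: "emeasure M (A n) \<le> ennreal (K * (a / b) ^ n)" for n
  proof -
    have "emeasure M ({z \<in> space M. 1 \<le> ennreal (1 / b ^ n) * W n z})
        \<le> ennreal (1 / b ^ n) * (\<integral>\<^sup>+z. W n z * indicator (space M) z \<partial>M)"
      by (intro nn_integral_Markov_inequality borel_measurable_times_ennreal W
          borel_measurable_indicator sets.top)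
    also have "(\<integral>\<^sup>+z. W n z * indicator (space M) z \<partial>M) = (\<integral>\<^sup>+z. W n z \<partial>M)"
      by (intro nn_integral_cong) auto
    also have "ennreal (1 / b ^ n) * (\<integral>\<^sup>+z. W n z \<partial>M) \<le> ennreal (1 / b ^ n) * ennreal (K * a ^ n)"
      by (intro mult_left_mono bound) simp
    also have "\<dots> = ennreal (K * (a / b) ^ n)"
      using ab b by (simp add: ennreal_mult[symmetric] power_divide field_simps)
    finally show ?thesis by (simp add: A_def)
  qed
  have "AE z in M. eventually (\<lambda>n. z \<in> space M - A n) sequentially"
  proof (rule borel_cantelli_AE1[OF A])
    show "emeasure M (A n) < \<infinity>" for n
      using em[of n] by (rule le_less_trans) simp
    show "summable (\<lambda>n. measure M (A n))"
    proof (rule summable_comparison_test[of _ "\<lambda>n. K * (a / b) ^ n"])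
      have "measure M (A n) \<le> K * (a / b) ^ n" for n
        unfolding measure_def using em[of n] ab b by (intro enn2real_leI) auto
      then show "\<exists>N. \<forall>n\<ge>N. norm (measure M (A n)) \<le> K * (a / b) ^ n" by simp
      show "summable (\<lambda>n. K * (a / b) ^ n)"
        using ab b by (intro summable_mult summable_geometric) simp
    qed
  qed
  then show ?thesis
  proof eventually_elim
    case (elim z)
    then show ?case
    proof eventually_elim
      case (elim n)
      then have "ennreal (1 / b ^ n) * W n z \<le> 1" by (simp add: A_def not_le less_imp_le)
      then have "ennreal (b ^ n) * (ennreal (1 / b ^ n) * W n z) \<le> ennreal (b ^ n) * 1"
        by (intro mult_left_mono) auto
      moreover have "ennreal (b ^ n) * ennreal (1 / b ^ n) = 1"
        using b by (subst ennreal_mult[symmetric]) auto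
      then have "ennreal (b ^ n) * (ennreal (1 / b ^ n) * W n z) = W n z"
        by (simp only: mult.assoc[symmetric] mult_1)
      ultimately show ?case by (simp only: mult_1_right)
    qed
  qed
qed

text \<open>
  The tail of \<open>\<kappa>\<close> decays faster than every exponential, because \<open>ln k\<close> exceeds every constant.
\<close>

lemma summable_sqrt_tail:
  fixes \<kappa> :: "nat pmf" and C :: real
  assumes \<beta>: "\<beta> > 0" and C: "C \<ge> 1"
    and tail: "eventually (\<lambda>j::nat. measure_pmf.prob \<kappa> {k. k \<ge> j} \<le> exp (- \<beta> * real j * ln (real j))) sequentially"
  shows "summable (\<lambda>k. sqrt (pmf \<kappa> k) * C ^ k)"
proof -
  have "filterlim (\<lambda>k. ln (real k)) at_top sequentially"
    by (rule filterlim_compose[OF ln_at_top filterlim_real_sequentially])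
  then have "eventually (\<lambda>k. 2 * (ln C + 1) / \<beta> \<le> ln (real k)) sequentially"
    by (simp add: filterlim_at_top)
  then have "eventually (\<lambda>k. norm (sqrt (pmf \<kappa> k) * C ^ k) \<le> exp (- 1) ^ k) sequentially"
    using tail
  proof eventually_elim
    case (elim k)
    have "pmf \<kappa> k \<le> measure_pmf.prob \<kappa> {k'. k' \<ge> k}"
      unfolding measure_pmf_single[symmetric] by (rule measure_pmf.finite_measure_mono) auto
    with elim(2) have "pmf \<kappa> k \<le> exp (- \<beta> * real k * ln (real k))" by linarith
    also have "\<dots> = (exp (- \<beta> * real k * ln (real k) / 2))\<^sup>2"
      by (simp add: power2_eq_square exp_add[symmetric])
    finally have "sqrt (pmf \<kappa> k) \<le> exp (- \<beta> * real k * ln (real k) / 2)"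
      by (intro real_le_lsqrt) auto
    then have "sqrt (pmf \<kappa> k) * C ^ k \<le> exp (- \<beta> * real k * ln (real k) / 2) * C ^ k"
      using C by (intro mult_right_mono) auto
    also have "\<dots> = exp (- \<beta> * real k * ln (real k) / 2) * exp (real k * ln C)"
      using C by (simp add: exp_of_nat_mult)
    also have "\<dots> = exp (real k * (ln C - \<beta> * ln (real k) / 2))"
      by (simp add: exp_add[symmetric] algebra_simps)
    also have "\<dots> \<le> exp (real k * (- 1))"
    proof -
      have "ln C - \<beta> * ln (real k) / 2 \<le> - 1" using elim(1) \<beta> by (simp add: field_simps)
      then show ?thesis by (subst exp_le_cancel_iff, intro mult_left_mono) auto
    qed
    also have "\<dots> = exp (- 1) ^ k" by (rule exp_of_nat_mult)
    finally show ?case using C by simp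
  qed
  moreover have "summable (\<lambda>k. exp (- 1 :: real) ^ k)" by (rule summable_geometric) simp
  ultimately show ?thesis by (rule summable_comparison_test_ev)
qed

section \<open>The likelihood integrated over the densities far from the truth\<close>

text \<open>
  This is the inequality between the root of a sum and the sum of the roots, squared.
\<close>

lemma suminf_square_le:
  fixes x :: "nat \<Rightarrow> ennreal"
  shows "(\<Sum>k. x k * x k) \<le> (\<Sum>k. x k) * (\<Sum>k. x k)"
proof -
  have "x k \<le> (\<Sum>k. x k)" for k
    using sum_le_suminf[of x "{k}"] by simp
  then have "(\<Sum>k. x k * x k) \<le> (\<Sum>k. (\<Sum>k. x k) * x k)"
    by (intro suminf_le mult_right_mono) auto
  then show ?thesis by simp
qed

lemma borel_data_dist: "borel_measurable (data_dist f0) = borel_measurable base_measure"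
  by (rule measurable_cong_sets) simp_all

lemma nn_integral_data_dist:
  assumes "f0 \<in> unit_funs" "\<phi> \<in> borel_measurable base_measure"
  shows "(\<integral>\<^sup>+y. \<phi> y \<partial>data_dist f0) = (\<integral>\<^sup>+y. ennreal (dens f0 y) * \<phi> y \<partial>base_measure)"
  unfolding data_dist_def
  using assms by (intro nn_integral_density measurable_compose[OF dens_measurable measurable_ennreal])

lemma measurable_ennreal_base:
  "g \<in> borel_measurable base_measure \<Longrightarrow> (\<lambda>z. ennreal (g z)) \<in> borel_measurable base_measure"
  by (rule measurable_compose[OF _ measurable_ennreal])

text \<open>
  Likelihood ratios divide by the density of the observations, which therefore must not vanish at them.
\<close>

lemma AE_data_pos:
  assumes "f0 \<in> unit_funs"
  shows "AE z in (\<Pi>\<^sub>M i\<in>(UNIV :: nat set). data_dist f0). \<forall>i. z i \<in> space base_measure \<and> 0 < dens f0 (z i)"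
proof -
  have "AE y in data_dist f0. y \<in> space base_measure \<and> 0 < dens f0 y"
    unfolding data_dist_def
    by (subst AE_density) (use assms in \<open>auto intro: measurable_ennreal_base dens_measurable simp: ennreal_less_zero_iff\<close>)
  then have "AE z in (\<Pi>\<^sub>M i\<in>(UNIV :: nat set). data_dist f0). z i \<in> space base_measure \<and> 0 < dens f0 (z i)" for i
    by (rule AE_PiM_component[rotated 2]) (simp_all add: prob_space_data_dist assms)
  then show ?thesis unfolding AE_all_countable by blast
qed

text \<open>
  The bound on \<open>N\<close> described at the beginning.  In the proof, \<open>R u n\<close> is the product of the roots of
  the likelihood ratios of a majorant \<open>u\<close>, and \<open>W n\<close> is the sum that dominates \<open>sqrt N\<close>.
\<close>

lemma numerator_bound:
  fixes \<kappa> :: "nat pmf"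
  assumes \<kappa>0: "pmf \<kappa> 0 = 0" and \<beta>: "\<beta> > 0"
    and tail: "eventually (\<lambda>j::nat. measure_pmf.prob \<kappa> {k. k \<ge> j} \<le> exp (- \<beta> * real j * ln (real j))) sequentially"
    and f0: "f0 \<in> unit_funs" and \<epsilon>: "\<epsilon> > 0"
  obtains b :: real where "0 < b" "b < 1"
    "AE z in (\<Pi>\<^sub>M i\<in>(UNIV :: nat set). data_dist f0). eventually (\<lambda>n.
       (\<integral>\<^sup>+f. indicator {f \<in> densities. hellinger (dens f0) f > \<epsilon>} f * ennreal (\<Prod>i<n. f (z i)) \<partial>prior \<kappa>)
         \<le> ennreal (b ^ n * (\<Prod>i<n. dens f0 (z i)))) sequentially"
proof -
  let ?P = "\<Pi>\<^sub>M i\<in>(UNIV :: nat set). data_dist f0"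
  let ?d = "dens f0"
  obtain \<rho> C :: real and U :: "nat \<Rightarrow> (real \<times> nat \<Rightarrow> real) set" where
    \<rho>: "0 < \<rho>" "\<rho> < 1" and C: "C \<ge> 1"
    and cov: "\<forall>k. finite (U k)" "\<forall>k\<ge>1. real (card (U k)) \<le> C ^ k"
      "\<forall>k. \<forall>u\<in>U k. u \<in> borel_measurable base_measure"
      "\<forall>k. \<forall>u\<in>U k. \<forall>z\<in>space base_measure. 0 \<le> u z \<and> u z \<le> 1"
      "\<forall>k. \<forall>u\<in>U k. (\<integral>z. sqrt (u z * ?d z) \<partial>base_measure) \<le> \<rho>"
      "\<forall>k\<ge>1. \<forall>w\<in>space (params k). hellinger ?d (step_dens k w) > \<epsilon> \<longrightarrow>
         (\<exists>u\<in>U k. \<forall>z\<in>space base_measure. step_dens k w z \<le> u z)"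
    using far_step_dens_cover[OF f0 \<epsilon>] by blast
  have U: "finite (U k)" "k \<ge> 1 \<Longrightarrow> real (card (U k)) \<le> C ^ k" for k
    using cov(1,2) by auto
  have Um: "u \<in> borel_measurable base_measure" if "u \<in> U k" for k u
    using cov(3) that by blast
  have Ub: "0 \<le> u z \<and> u z \<le> 1" if "u \<in> U k" "z \<in> space base_measure" for k u z
    using cov(4) that by blast
  have Ua: "(\<integral>z. sqrt (u z * ?d z) \<partial>base_measure) \<le> \<rho>" if "u \<in> U k" for k u
    using cov(5) that by blast
  have cover: "\<exists>u\<in>U k. \<forall>z\<in>space base_measure. step_dens k w z \<le> u z"
    if "k \<ge> 1" "w \<in> space (params k)" "hellinger ?d (step_dens k w) > \<epsilon>" for k w
    using cov(6) that by blast
  define S where "S = (\<Sum>k. sqrt (pmf \<kappa> k) * C ^ k)"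
  have summ: "summable (\<lambda>k. sqrt (pmf \<kappa> k) * C ^ k)" by (rule summable_sqrt_tail[OF \<beta> C tail])
  have S0: "S \<ge> 0" unfolding S_def using C by (intro suminf_nonneg summ) auto
  define R where "R u n z = (\<Prod>i<n. ennreal (sqrt (u (z i) / ?d (z i))))" for u :: "real \<times> nat \<Rightarrow> real" and n and z :: "nat \<Rightarrow> real \<times> nat"
  define X where "X n k z = ennreal (sqrt (pmf \<kappa> k)) * (\<Sum>u\<in>U k. R u n z)" for n k z
  define W where "W n z = (\<Sum>k. X n k z)" for n z
  have \<phi>m: "(\<lambda>y. ennreal (sqrt (u y / ?d y))) \<in> borel_measurable base_measure" if "u \<in> U k" for u k
    by (intro measurable_ennreal_base measurable_compose[OF _ borel_measurable_sqrt]
        borel_measurable_divide Um[OF that] dens_measurable f0)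
  have Rm: "R u n \<in> borel_measurable ?P" if "u \<in> U k" for u k n
    unfolding R_def using \<phi>m[OF that]
    by (intro borel_measurable_prod_ennreal measurable_coord_comp) (simp_all add: borel_data_dist)
  have Xm: "X n k \<in> borel_measurable ?P" for n k
    unfolding X_def by (intro borel_measurable_times_ennreal borel_measurable_const borel_measurable_sum Rm)
  have Wm: "W n \<in> borel_measurable ?P" for n
    unfolding W_def by (intro borel_measurable_suminf_order Xm)
  have Rint: "(\<integral>\<^sup>+z. R u n z \<partial>?P) \<le> ennreal (\<rho> ^ n)" if u: "u \<in> U k" for u k n
  proof -
    have "(\<integral>\<^sup>+z. R u n z \<partial>?P) = (\<integral>\<^sup>+y. ennreal (sqrt (u y / ?d y)) \<partial>data_dist f0) ^ n"
      unfolding R_def using \<phi>m[OF u]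
      by (intro nn_integral_PiM_prod prob_space_data_dist f0) (simp_all add: borel_data_dist)
    also have "(\<integral>\<^sup>+y. ennreal (sqrt (u y / ?d y)) \<partial>data_dist f0)
        = (\<integral>\<^sup>+y. ennreal (?d y) * ennreal (sqrt (u y / ?d y)) \<partial>base_measure)"
      by (rule nn_integral_data_dist[OF f0 \<phi>m[OF u]])
    also have "\<dots> = (\<integral>\<^sup>+y. ennreal (sqrt (u y * ?d y)) \<partial>base_measure)"
    proof (rule nn_integral_cong)
      fix y assume y: "y \<in> space base_measure"
      note db = dens_bounds[OF f0 y]
      have "?d y * sqrt (u y / ?d y) = sqrt (u y * ?d y)"
        using db by (cases "?d y = 0") (simp_all add: real_sqrt_divide real_sqrt_mult field_simps)
      then show "ennreal (?d y) * ennreal (sqrt (u y / ?d y)) = ennreal (sqrt (u y * ?d y))"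
        using db Ub[OF u y] by (simp add: ennreal_mult[symmetric])
    qed
    also have "\<dots> = ennreal (\<integral>y. sqrt (u y * ?d y) \<partial>base_measure)"
    proof (rule nn_integral_eq_integral)
      show "integrable base_measure (\<lambda>y. sqrt (u y * ?d y))"
      proof (rule integrable_base_bounded[where C = 1])
        show "(\<lambda>y. sqrt (u y * ?d y)) \<in> borel_measurable base_measure"
          by (intro measurable_compose[OF _ borel_measurable_sqrt] borel_measurable_times Um[OF u] dens_measurable f0)
        show "\<bar>sqrt (u y * ?d y)\<bar> \<le> 1" if "y \<in> space base_measure" for y
          using Ub[OF u that] dens_bounds[OF f0 that] by (simp add: mult_le_one)
      qed
      show "AE y in base_measure. 0 \<le> sqrt (u y * ?d y)"
        using Ub[OF u] dens_bounds[OF f0] by (intro AE_I2) simp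
    qed
    also have "\<dots> ^ n \<le> ennreal \<rho> ^ n"
      by (intro power_mono ennreal_leI Ua[OF u]) simp
    also have "\<dots> = ennreal (\<rho> ^ n)" using \<rho> by (simp add: ennreal_power)
    finally show ?thesis .
  qed
  have Xint: "(\<integral>\<^sup>+z. X n k z \<partial>?P) \<le> ennreal (sqrt (pmf \<kappa> k) * C ^ k) * ennreal (\<rho> ^ n)" for n k
  proof (cases "k = 0")
    case True
    then show ?thesis by (simp add: X_def \<kappa>0)
  next
    case False
    have "(\<integral>\<^sup>+z. X n k z \<partial>?P) = ennreal (sqrt (pmf \<kappa> k)) * (\<Sum>u\<in>U k. \<integral>\<^sup>+z. R u n z \<partial>?P)"
      unfolding X_def
      by (subst nn_integral_cmult, intro borel_measurable_sum Rm)
         (simp_all add: nn_integral_sum[OF Rm])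
    also have "\<dots> \<le> ennreal (sqrt (pmf \<kappa> k)) * (\<Sum>u\<in>U k. ennreal (\<rho> ^ n))"
      by (intro mult_left_mono sum_mono Rint) auto
    also have "\<dots> = ennreal (sqrt (pmf \<kappa> k)) * (ennreal (real (card (U k))) * ennreal (\<rho> ^ n))"
      by (simp add: ennreal_of_nat_eq_real_of_nat del: sum_ennreal)
    also have "\<dots> \<le> ennreal (sqrt (pmf \<kappa> k)) * (ennreal (C ^ k) * ennreal (\<rho> ^ n))"
      using False U(2)[of k] by (intro mult_left_mono mult_right_mono ennreal_leI) auto
    also have "\<dots> = ennreal (sqrt (pmf \<kappa> k) * C ^ k) * ennreal (\<rho> ^ n)"
      using C by (simp add: ennreal_mult mult.assoc)
    finally show ?thesis .
  qed
  have Wint: "(\<integral>\<^sup>+z. W n z \<partial>?P) \<le> ennreal (S * \<rho> ^ n)" for n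
  proof -
    have "(\<integral>\<^sup>+z. W n z \<partial>?P) = (\<Sum>k. \<integral>\<^sup>+z. X n k z \<partial>?P)"
      unfolding W_def by (rule nn_integral_suminf) (rule Xm)
    also have "\<dots> \<le> (\<Sum>k. ennreal (sqrt (pmf \<kappa> k) * C ^ k) * ennreal (\<rho> ^ n))"
      by (intro suminf_le Xint) auto
    also have "\<dots> = (\<Sum>k. ennreal (sqrt (pmf \<kappa> k) * C ^ k)) * ennreal (\<rho> ^ n)" by simp
    also have "(\<Sum>k. ennreal (sqrt (pmf \<kappa> k) * C ^ k)) = ennreal S"
      unfolding S_def using C by (intro suminf_ennreal2 summ) auto
    finally show ?thesis using S0 \<rho> by (simp add: ennreal_mult)
  qed
  \<comment> \<open>any number strictly between \<open>\<rho>\<close> and \<open>1\<close> would do; the root makes the final rate equal to \<open>\<rho>\<close>\<close>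
  define a where "a = sqrt \<rho>"
  have a: "\<rho> < a" "0 < a" "a < 1" "a * a = \<rho>"
    unfolding a_def using \<rho> by (auto intro: real_less_rsqrt simp: power2_eq_square)
  have "AE z in ?P. eventually (\<lambda>n. W n z \<le> ennreal (a ^ n)) sequentially"
    using \<rho> a by (intro AE_eventually_le_geometric[OF Wm Wint S0]) auto
  then have "AE z in ?P. eventually (\<lambda>n.
       (\<integral>\<^sup>+f. indicator {f \<in> densities. hellinger ?d f > \<epsilon>} f * ennreal (\<Prod>i<n. f (z i)) \<partial>prior \<kappa>)
         \<le> ennreal (\<rho> ^ n * (\<Prod>i<n. ?d (z i)))) sequentially"
    using AE_data_pos[OF f0]
  proof eventually_elim
    case (elim z)
    then have zs: "z i \<in> space base_measure" and d0: "0 < ?d (z i)" for i by auto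
    from elim(1) show ?case
    proof eventually_elim
      case (elim n)
      let ?H = "{f \<in> densities. hellinger ?d f > \<epsilon>}"
      let ?p = "\<lambda>f. ennreal (\<Prod>i<n. f (z i))"
      define D where "D = (\<Prod>i<n. ?d (z i))"
      have D0: "0 \<le> D" unfolding D_def using d0 by (intro prod_nonneg) (auto intro: less_imp_le)
      have Hs: "?H \<in> sets density_algebra"
      proof -
        have "?H = space hellinger_borel - hellinger_nbhd f0 \<epsilon>" by (auto simp: hellinger_nbhd_def)
        then show ?thesis
          using hellinger_borel_subset[OF sets.compl_sets[OF hellinger_nbhd_borel[OF f0]]] by simp
      qed
      have hm: "(\<lambda>f. indicator ?H f * ?p f) \<in> borel_measurable density_algebra"
        by (intro borel_measurable_times_ennreal borel_measurable_indicator Hs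
            measurable_compose[OF _ measurable_ennreal] borel_measurable_prod measurable_evaluation zs)
      have level: "ennreal (pmf \<kappa> k) * (\<integral>\<^sup>+w. indicator ?H (step_dens k w) * ?p (step_dens k w) \<partial>params k)
          \<le> ennreal D * (X n k z * X n k z)" for k
      proof (cases "k = 0")
        case False
        let ?Y = "\<Sum>u\<in>U k. R u n z"
        have "indicator ?H (step_dens k w) * ?p (step_dens k w) \<le> ennreal D * (?Y * ?Y)"
          if w: "w \<in> space (params k)" for w
        proof (cases "step_dens k w \<in> ?H")
          case True
          then obtain u where u: "u \<in> U k" "\<forall>z\<in>space base_measure. step_dens k w z \<le> u z"
            using cover[of k w] False w by auto
          have r0: "0 \<le> sqrt (u (z i) / ?d (z i))" for i
            using Ub[OF u(1) zs[of i]] d0[of i] by simp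
          have "(\<Prod>i<n. step_dens k w (z i)) \<le> (\<Prod>i<n. u (z i))"
            using u(2) zs dens_bounds[OF step_fun_unit_funs[OF w] zs] by (intro prod_mono) blast
          also have "\<dots> = (\<Prod>i<n. ?d (z i) * (sqrt (u (z i) / ?d (z i)) * sqrt (u (z i) / ?d (z i))))"
          proof (rule prod.cong)
            fix i
            show "u (z i) = ?d (z i) * (sqrt (u (z i) / ?d (z i)) * sqrt (u (z i) / ?d (z i)))"
              using Ub[OF u(1) zs[of i]] d0[of i] by simp
          qed simp
          also have "\<dots> = D * ((\<Prod>i<n. sqrt (u (z i) / ?d (z i))) * (\<Prod>i<n. sqrt (u (z i) / ?d (z i))))"
            by (simp only: D_def prod.distrib)
          finally have "?p (step_dens k w) \<le> ennreal (D * ((\<Prod>i<n. sqrt (u (z i) / ?d (z i))) * (\<Prod>i<n. sqrt (u (z i) / ?d (z i)))))"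
            by (rule ennreal_leI)
          also have "\<dots> = ennreal D * (R u n z * R u n z)"
            unfolding R_def using D0 r0 by (simp add: prod_ennreal ennreal_mult prod_nonneg)
          also have "\<dots> \<le> ennreal D * (?Y * ?Y)"
          proof -
            have "R u n z \<le> ?Y" using u(1) U(1) by (intro member_le_sum) auto
            then show ?thesis by (intro mult_left_mono mult_mono) auto
          qed
          finally show ?thesis using True by (simp add: indicator_def)
        next
          case False
          show ?thesis by (simp only: indicator_simps(2)[OF False] mult_zero_left zero_le)
        qed
        then have "(\<integral>\<^sup>+w. indicator ?H (step_dens k w) * ?p (step_dens k w) \<partial>params k)
            \<le> (\<integral>\<^sup>+w. ennreal D * (?Y * ?Y) \<partial>params k)"
          by (intro nn_integral_mono)
        also have "\<dots> = ennreal D * (?Y * ?Y)"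
          using prob_space.emeasure_space_1[OF prob_space_params, of k] by simp
        finally have "ennreal (pmf \<kappa> k) * (\<integral>\<^sup>+w. indicator ?H (step_dens k w) * ?p (step_dens k w) \<partial>params k)
            \<le> ennreal (pmf \<kappa> k) * (ennreal D * (?Y * ?Y))"
          by (intro mult_left_mono) auto
        also have "\<dots> = ennreal (sqrt (pmf \<kappa> k)) * ennreal (sqrt (pmf \<kappa> k)) * (ennreal D * (?Y * ?Y))"
          by (simp add: ennreal_mult[symmetric])
        also have "\<dots> = ennreal D * (X n k z * X n k z)" by (simp add: X_def mult_ac)
        finally show ?thesis .
      qed (simp add: \<kappa>0)
      have "(\<integral>\<^sup>+f. indicator ?H f * ?p f \<partial>prior \<kappa>)
          = (\<Sum>k. ennreal (pmf \<kappa> k) * (\<integral>\<^sup>+w. indicator ?H (step_dens k w) * ?p (step_dens k w) \<partial>params k))"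
        by (rule nn_integral_prior[OF hm])
      also have "\<dots> \<le> (\<Sum>k. ennreal D * (X n k z * X n k z))"
        by (intro suminf_le level) auto
      also have "\<dots> = ennreal D * (\<Sum>k. X n k z * X n k z)" by simp
      also have "\<dots> \<le> ennreal D * (W n z * W n z)"
        unfolding W_def by (intro mult_left_mono suminf_square_le) simp
      also have "\<dots> \<le> ennreal D * (ennreal (a ^ n) * ennreal (a ^ n))"
        by (intro mult_left_mono mult_mono elim) auto
      also have "\<dots> = ennreal (\<rho> ^ n * D)"
        using D0 a \<rho> by (simp add: ennreal_mult[symmetric] power_mult_distrib[symmetric] mult.commute)
      finally show ?case by (simp add: D_def)
    qed
  qed
  with \<rho> that show thesis by blast
qed

section \<open>A lower bound for the marginal likelihood\<close>

text \<open>
  A measurable function is almost everywhere a limit of continuous ones.  Clipping these to the unit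
  interval permits dominated convergence.
\<close>

lemma continuous_L1_approx:
  assumes f0: "f0 \<in> unit_funs" and \<tau>: "\<tau> > 0"
  obtains h where "continuous_on UNIV h" "\<And>x. 0 \<le> h x \<and> h x \<le> 1"
    "(\<integral>x. \<bar>f0 x - h x\<bar> \<partial>unit_uniform) < \<tau>"
proof -
  define F where "F x = indicator {0..1} x *\<^sub>R f0 x" for x
  have "f0 \<in> borel_measurable (restrict_space borel {0..1})"
    using f0 by (simp add: unit_funs_def)
  then have "F \<in> borel_measurable borel"
    unfolding F_def by (subst (asm) borel_measurable_restrict_space_iff) auto
  then have "F \<in> borel_measurable lborel" by (simp add: measurable_lborel2)
  then have "F \<in> borel_measurable lebesgue" by (rule measurable_completion)
  then have "F measurable_on UNIV"
    by (rule lebesgue_measurable_imp_measurable_on_real) simp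
  then obtain N g where N: "negligible N" and gc: "\<And>n. continuous_on UNIV (g n)"
    and lim: "\<And>x. x \<notin> N \<Longrightarrow> (\<lambda>n. g n x) \<longlonglongrightarrow> F x"
    unfolding measurable_on_def by auto
  define h where "h n x = max 0 (min 1 (g n x))" for n :: nat and x
  have hc: "continuous_on UNIV (h n)" for n
    unfolding h_def by (intro continuous_intros gc)
  have hb: "0 \<le> h n x \<and> h n x \<le> 1" for n x by (simp add: h_def)
  have "(\<lambda>n. \<integral>x. \<bar>f0 x - h n x\<bar> \<partial>unit_uniform) \<longlonglongrightarrow> (\<integral>x. 0 \<partial>unit_uniform)"
  proof (rule integral_dominated_convergence[where w = "\<lambda>_. 1"])
    show "(\<lambda>x. \<bar>f0 x - h n x\<bar>) \<in> borel_measurable unit_uniform" for n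
      by (intro borel_measurable_abs borel_measurable_diff unit_fun_measurable f0
          borel_imp_unit_measurable borel_measurable_continuous_onI hc)
    show "AE x in unit_uniform. norm \<bar>f0 x - h n x\<bar> \<le> 1" for n
    proof (rule AE_I2)
      fix x assume "x \<in> space unit_uniform"
      then show "norm \<bar>f0 x - h n x\<bar> \<le> 1"
        using unit_fun_range[OF f0, of x] hb[of n x] by auto
    qed
    have "AE x in lebesgue. x \<notin> N"
      using N by (intro AE_not_in) (simp add: negligible_iff_null_sets)
    then have "AE x in lborel. x \<notin> N" by (simp only: AE_completion_iff)
    then have "AE x in unit_uniform. x \<notin> N"
      unfolding unit_uniform_def by (subst AE_restrict_space_iff) (auto elim: eventually_mono)
    moreover have "AE x in unit_uniform. x \<in> {0..1}" by (rule AE_I2) simp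
    ultimately show "AE x in unit_uniform. (\<lambda>n. \<bar>f0 x - h n x\<bar>) \<longlonglongrightarrow> 0"
    proof eventually_elim
      case (elim x)
      have "(\<lambda>n. \<bar>f0 x - h n x\<bar>) \<longlonglongrightarrow> \<bar>f0 x - max 0 (min 1 (F x))\<bar>"
        unfolding h_def by (intro tendsto_intros lim elim)
      moreover have "max 0 (min 1 (F x)) = f0 x"
        using unit_fun_range[OF f0 elim(2)] elim(2) by (simp add: F_def)
      ultimately show ?case by simp
    qed
  qed (auto intro: integrable_unit_bounded[where C = 1])
  then have "(\<lambda>n. \<integral>x. \<bar>f0 x - h n x\<bar> \<partial>unit_uniform) \<longlonglongrightarrow> 0" by simp
  then have "eventually (\<lambda>n. (\<integral>x. \<bar>f0 x - h n x\<bar> \<partial>unit_uniform) < \<tau>) sequentially"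
    using \<tau> by (rule order_tendstoD(2))
  then obtain n where "(\<integral>x. \<bar>f0 x - h n x\<bar> \<partial>unit_uniform) < \<tau>"
    using eventually_happens'[OF sequentially_bot] by blast
  then show thesis using that[of "h n"] hc hb by blast
qed

lemma emeasure_unit_subset:
  assumes "S \<in> sets borel" "S \<subseteq> {0..1}"
  shows "S \<in> sets unit_uniform" "emeasure unit_uniform S = emeasure lborel S"
proof -
  show "S \<in> sets unit_uniform"
    unfolding sets_unit_uniform using assms by (subst sets_restrict_space_iff) auto
  show "emeasure unit_uniform S = emeasure lborel S"
    unfolding unit_uniform_def using assms by (intro emeasure_restrict_space) auto
qed

text \<open>
  The positive prior probability of the parameters near a given function comes from such boxes.
\<close>

lemma emeasure_unit_box:
  fixes A :: "nat \<Rightarrow> real set"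
  assumes "finite I" "\<And>i. i \<in> I \<Longrightarrow> A i \<in> sets borel" "\<And>i. i \<in> I \<Longrightarrow> A i \<subseteq> {0..1}"
    "\<And>i. i \<in> I \<Longrightarrow> emeasure lborel (A i) = ennreal l" "l > 0"
  shows "Pi\<^sub>E I A \<in> sets (\<Pi>\<^sub>M i\<in>I. unit_uniform)" "emeasure (\<Pi>\<^sub>M i\<in>I. unit_uniform) (Pi\<^sub>E I A) > 0"
proof -
  interpret product_prob_space "\<lambda>_. unit_uniform" I
    by (intro product_prob_spaceI prob_space_unit_uniform)
  note A = emeasure_unit_subset[OF assms(2,3)]
  show "Pi\<^sub>E I A \<in> sets (\<Pi>\<^sub>M i\<in>I. unit_uniform)"
    using assms(1) A(1) by (intro sets_PiM_I_finite) auto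
  have "emeasure (\<Pi>\<^sub>M i\<in>I. unit_uniform) (Pi\<^sub>E I A) = (\<Prod>i\<in>I. ennreal l)"
    using assms(1,4) A by (subst emeasure_PiM) auto
  also have "\<dots> = ennreal (l ^ card I)"
    using assms(5) by (simp add: ennreal_power)
  finally show "emeasure (\<Pi>\<^sub>M i\<in>I. unit_uniform) (Pi\<^sub>E I A) > 0"
    using assms(5) by simp
qed

text \<open>
  For large \<open>k\<close>, let the \<open>j\<close>-th split point range over \<open>{(j - 1) / k ..< j / k}\<close> and the \<open>i\<close>-th value
  over the numbers within \<open>\<tau>\<close> of \<open>h (i / k)\<close>.  Then the piece that contains \<open>x\<close> has an index \<open>i\<close> with
  \<open>\<bar>i / k - x\<bar> \<le> 2 / k\<close>, so uniform continuity applies at every \<open>x\<close>, without exceptional sets near the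
  split points.
\<close>

lemma step_fun_near_continuous:
  assumes hc: "continuous_on UNIV h" and hb: "\<And>x. \<tau> \<le> h x \<and> h x \<le> 1 - \<tau>" and \<tau>: "\<tau> > 0"
  obtains k B where "k \<ge> 1" "B \<in> sets (params k)" "emeasure (params k) B > 0"
    "\<And>w x. w \<in> B \<Longrightarrow> x \<in> {0..1} \<Longrightarrow> \<bar>step_fun (k, w) x - h x\<bar> \<le> 2 * \<tau>"
proof -
  have "uniformly_continuous_on {0..1} h"
    by (intro compact_uniformly_continuous continuous_on_subset[OF hc]) auto
  then obtain d where d: "d > 0"
    "\<And>x y. x \<in> {0..1} \<Longrightarrow> y \<in> {0..1} \<Longrightarrow> dist x y < d \<Longrightarrow> dist (h x) (h y) < \<tau>"
    using \<tau> unfolding uniformly_continuous_on_def by metis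
  obtain k :: nat where k: "real k > 2 / d" using reals_Archimedean2 by blast
  have "0 < 2 / d" using d by simp
  then have k1: "k \<ge> 1" using k by (cases k) auto
  have kd: "2 / real k < d" using k k1 d by (simp add: field_simps)
  define A1 where "A1 j = {(real j - 1) / k ..< real j / k}" for j
  define A2 where "A2 i = {h (real i / k) - \<tau> .. h (real i / k) + \<tau>}" for i :: nat
  define B where "B = Pi\<^sub>E {1..<k} A1 \<times> Pi\<^sub>E {1..k} A2"
  have A1s: "A1 j \<subseteq> {0..1}" if "j \<in> {1..<k}" for j
  proof -
    have "0 \<le> (real j - 1) / k" "real j / k \<le> 1" using that by auto
    then show ?thesis unfolding A1_def by fastforce
  qed
  have A2s: "A2 i \<subseteq> {0..1}" for i
    using hb[of "real i / k"] by (auto simp: A2_def)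
  have B1: "Pi\<^sub>E {1..<k} A1 \<in> sets (\<Pi>\<^sub>M i\<in>{1..<k}. unit_uniform)"
    "emeasure (\<Pi>\<^sub>M i\<in>{1..<k}. unit_uniform) (Pi\<^sub>E {1..<k} A1) > 0"
  proof -
    have "emeasure lborel (A1 j) = ennreal (1 / k)" if "j \<in> {1..<k}" for j
      unfolding A1_def using k1 by (subst emeasure_lborel_Ico) (auto simp: field_simps)
    moreover have "A1 j \<in> sets borel" for j unfolding A1_def by (rule atLeastLessThan_borel)
    ultimately show "Pi\<^sub>E {1..<k} A1 \<in> sets (\<Pi>\<^sub>M i\<in>{1..<k}. unit_uniform)"
      "emeasure (\<Pi>\<^sub>M i\<in>{1..<k}. unit_uniform) (Pi\<^sub>E {1..<k} A1) > 0"
      using emeasure_unit_box[of "{1..<k}" A1 "1 / real k"] A1s k1 by auto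
  qed
  have B2: "Pi\<^sub>E {1..k} A2 \<in> sets (\<Pi>\<^sub>M i\<in>{1..k}. unit_uniform)"
    "emeasure (\<Pi>\<^sub>M i\<in>{1..k}. unit_uniform) (Pi\<^sub>E {1..k} A2) > 0"
  proof -
    have "emeasure lborel (A2 j) = ennreal (2 * \<tau>)" for j
      unfolding A2_def using \<tau> by (subst emeasure_lborel_Icc) auto
    moreover have "A2 j \<in> sets borel" for j unfolding A2_def by (rule atLeastAtMost_borel)
    ultimately show "Pi\<^sub>E {1..k} A2 \<in> sets (\<Pi>\<^sub>M i\<in>{1..k}. unit_uniform)"
      "emeasure (\<Pi>\<^sub>M i\<in>{1..k}. unit_uniform) (Pi\<^sub>E {1..k} A2) > 0"
      using emeasure_unit_box[of "{1..k}" A2 "2 * \<tau>"] A2s \<tau> by auto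
  qed
  have Bs: "B \<in> sets (params k)"
    unfolding B_def params_def using B1(1) B2(1) by (rule pair_measureI)
  have Be: "emeasure (params k) B > 0"
  proof -
    interpret prob_space "\<Pi>\<^sub>M i\<in>{1..k}. unit_uniform"
      by (intro prob_space_PiM prob_space_unit_uniform)
    have "emeasure (params k) B = emeasure (\<Pi>\<^sub>M i\<in>{1..<k}. unit_uniform) (Pi\<^sub>E {1..<k} A1)
        * emeasure (\<Pi>\<^sub>M i\<in>{1..k}. unit_uniform) (Pi\<^sub>E {1..k} A2)"
      unfolding B_def params_def using B1(1) B2(1) by (rule emeasure_pair_measure_Times)
    then show ?thesis using B1(2) B2(2) by (simp add: ennreal_zero_less_mult_iff)
  qed
  have near: "\<bar>step_fun (k, w) x - h x\<bar> \<le> 2 * \<tau>" if w: "w \<in> B" and x: "x \<in> {0..1}" for w x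
  proof -
    obtain v s where ws: "w = (v, s)" by (cases w)
    have v: "(real j - 1) / k \<le> v j" "v j < real j / k" if "j \<in> {1..<k}" for j
      using w that unfolding ws B_def A1_def by (auto simp: PiE_iff)
    define c where "c = cell k x"
    have c: "real c \<le> real k * x" "real k * x < real c + 1" "c \<le> k"
      unfolding c_def using x cell_bounds[of x k] cell_le[of x k] by auto
    define i where "i = Suc (count_below k v x)"
    have ik: "i \<in> {1..k}" using count_below_less[OF k1, of v x] by (auto simp: i_def)
    have up: "i \<le> c + 2"
    proof -
      have "{j \<in> {1..<k}. v j \<le> x} \<subseteq> {1..c + 1}"
      proof
        fix j assume "j \<in> {j \<in> {1..<k}. v j \<le> x}"
        then have j: "j \<in> {1..<k}" "v j \<le> x" by auto
        then have "(real j - 1) / k \<le> x" using v(1)[OF j(1)] by linarith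
        then have "real j - 1 \<le> real k * x" using k1 by (simp add: field_simps)
        then have "real j < real c + 2" using c by linarith
        then show "j \<in> {1..c + 1}" using j by auto
      qed
      then have "count_below k v x \<le> card {1..c + 1}"
        unfolding count_below_def by (intro card_mono) auto
      then show ?thesis by (simp add: i_def)
    qed
    have lo: "c + 1 \<le> i \<or> i = k"
    proof (rule ccontr)
      assume "\<not> (c + 1 \<le> i \<or> i = k)"
      then have i: "i \<le> c" "i < k" using ik by auto
      have "{1..i} \<subseteq> {j \<in> {1..<k}. v j \<le> x}"
      proof
        fix j assume j: "j \<in> {1..i}"
        then have jk: "j \<in> {1..<k}" using i by auto
        have "real j / k \<le> real c / k" using j i by (intro divide_right_mono) auto
        also have "\<dots> \<le> x" using c k1 by (simp add: field_simps)
        finally show "j \<in> {j \<in> {1..<k}. v j \<le> x}" using v(2)[OF jk] jk by auto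
      qed
      then have "card {1..i} \<le> count_below k v x"
        unfolding count_below_def by (intro card_mono) auto
      then show False by (simp add: i_def)
    qed
    have "\<bar>real i - real k * x\<bar> \<le> 2"
    proof (cases "c + 1 \<le> i")
      case True
      then show ?thesis using up c by linarith
    next
      case False
      then have "i = k" "c = k" using lo c(3) by auto
      moreover have "real k * x \<le> real k" using x by (simp add: mult_left_le)
      ultimately show ?thesis using c by linarith
    qed
    then have "\<bar>real i / k - x\<bar> \<le> 2 / k"
      using k1 by (simp add: abs_le_iff field_simps)
    then have "dist (real i / k) x < d" using kd by (simp add: dist_real_def)
    moreover have "real i / k \<in> {0..1}" using ik by simp
    ultimately have "\<bar>h (real i / k) - h x\<bar> < \<tau>"
      using d(2) x by (simp add: dist_real_def)
    moreover have "s i \<in> A2 i"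
      using w ik unfolding ws B_def by (auto simp: PiE_iff)
    then have "\<bar>s i - h (real i / k)\<bar> \<le> \<tau>" by (auto simp: A2_def abs_le_iff)
    moreover have "step_fun (k, w) x = s i"
      unfolding ws i_def by (rule step_fun_eq[OF x k1])
    ultimately show ?thesis by linarith
  qed
  show thesis by (rule that[OF k1 Bs Be near])
qed

text \<open>
  The bound on \<open>M\<close> described at the beginning, with the function \<open>l\<close> given by
  \<open>(1 - \<eta>) * dens g z + \<eta> / 4\<close> for the continuous approximation \<open>g\<close> of \<open>f0\<close>.
\<close>

lemma denominator_bound:
  fixes \<kappa> :: "nat pmf" and q :: real
  assumes \<kappa>pos: "\<And>k. k \<ge> 1 \<Longrightarrow> pmf \<kappa> k > 0" and f0: "f0 \<in> unit_funs" and q: "q > 1"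
  obtains c :: real where "c > 0"
    "AE z in (\<Pi>\<^sub>M i\<in>(UNIV :: nat set). data_dist f0). eventually (\<lambda>n.
       ennreal (c * (\<Prod>i<n. dens f0 (z i)) / q ^ n) \<le> (\<integral>\<^sup>+f. ennreal (\<Prod>i<n. f (z i)) \<partial>prior \<kappa>)) sequentially"
proof -
  let ?P = "\<Pi>\<^sub>M i\<in>(UNIV :: nat set). data_dist f0"
  let ?d = "dens f0"
  \<comment> \<open>\<open>a\<close> will bound \<open>\<integral> d\<^sup>2 / l\<close>; the gap to \<open>q\<close> is spent on the Borel-Cantelli argument\<close>
  define a where "a = (1 + q) / 2"
  have a: "1 < a" "a < q" using q by (auto simp: a_def)
  \<comment> \<open>\<open>\<eta>\<close> makes \<open>1 / (1 - \<eta>)\<close> at most \<open>1 + (a - 1) / 2\<close>, and \<open>\<tau>\<close> makes \<open>8 / \<eta> * \<tau>\<close> equal to \<open>(a - 1) / 2\<close>\<close>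
  define \<eta> where "\<eta> = min (1 / 2) ((a - 1) / 4)"
  have \<eta>: "0 < \<eta>" "\<eta> \<le> 1 / 2" "\<eta> \<le> (a - 1) / 4" unfolding \<eta>_def using a by (simp, simp, intro min.cobounded2)
  define \<tau> where "\<tau> = \<eta> * (a - 1) / 16"
  have \<tau>: "\<tau> > 0" using \<eta> a by (simp add: \<tau>_def)
  obtain h0 where h0: "continuous_on UNIV h0" "\<And>x. 0 \<le> h0 x \<and> h0 x \<le> 1"
    "(\<integral>x. \<bar>f0 x - h0 x\<bar> \<partial>unit_uniform) < \<tau>"
    using continuous_L1_approx[OF f0 \<tau>] by blast
  \<comment> \<open>moving \<open>h0\<close> towards \<open>1/2\<close> keeps both labels possible everywhere\<close>
  define h where "h x = (1 - \<eta>) * h0 x + \<eta> / 2" for x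
  have hc: "continuous_on UNIV h" unfolding h_def by (intro continuous_intros h0(1))
  have hb: "\<eta> / 8 \<le> h x \<and> h x \<le> 1 - \<eta> / 8" for x
  proof -
    have "0 \<le> (1 - \<eta>) * h0 x" "(1 - \<eta>) * h0 x \<le> 1 - \<eta>"
      using h0(2)[of x] \<eta> by (simp_all add: mult_left_le)
    then show ?thesis using \<eta> unfolding h_def by linarith
  qed
  have e8: "\<eta> / 8 > 0" using \<eta> by simp
  obtain k B where k: "k \<ge> 1" and B: "B \<in> sets (params k)" "emeasure (params k) B > 0"
    and near: "\<And>w x. w \<in> B \<Longrightarrow> x \<in> {0..1} \<Longrightarrow> \<bar>step_fun (k, w) x - h x\<bar> \<le> 2 * (\<eta> / 8)"
    using step_fun_near_continuous[OF hc hb e8] by blast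
  define g where "g = restrict h0 {0..1}"
  have g: "g \<in> unit_funs"
  proof -
    have "h0 \<in> borel_measurable (restrict_space borel {0..1})"
      by (intro measurable_restrict_space1 borel_measurable_continuous_onI h0(1))
    then have "g \<in> borel_measurable (restrict_space borel {0..1})"
      by (subst measurable_cong[where g = h0]) (auto simp: g_def space_restrict_space)
    then show ?thesis using h0(2) by (auto simp: unit_funs_def g_def)
  qed
  define l where "l z = (1 - \<eta>) * dens g z + \<eta> / 4" for z
  have lm: "l \<in> borel_measurable base_measure"
    unfolding l_def by (intro borel_measurable_add borel_measurable_times borel_measurable_const dens_measurable g)
  have lb: "\<eta> / 4 \<le> l z" "(1 - \<eta>) * dens g z \<le> l z" if "z \<in> space base_measure" for z
    using dens_bounds[OF g that] \<eta> by (auto simp: l_def)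
  have l_le: "l z \<le> step_dens k w z" if w: "w \<in> B" and z: "z \<in> space base_measure" for w z
    using z
  proof (cases rule: base_cases)
    case (1 x)
    have "step_fun (k, w) x \<le> h x + \<eta> / 4" using near[OF w 1(1)] by linarith
    then show ?thesis using 1 by (simp add: l_def g_def h_def dens_simps algebra_simps)
  next
    case (2 x)
    have "h x - \<eta> / 4 \<le> step_fun (k, w) x" using near[OF w 2(1)] by linarith
    then show ?thesis using 2 by (simp add: l_def g_def h_def dens_simps)
  qed
  \<comment> \<open>Since \<open>d \<le> dens g + \<bar>d - dens g\<bar>\<close>, the integrand \<open>d\<^sup>2 / l\<close> is at most
    \<open>d / (1 - \<eta>) + (4 / \<eta>) * \<bar>d - dens g\<bar>\<close>.\<close>
  have chi: "(\<integral>\<^sup>+y. ennreal (?d y / l y) \<partial>data_dist f0) \<le> ennreal a"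
  proof -
    have m: "(\<lambda>y. ?d y / l y) \<in> borel_measurable base_measure"
      by (intro borel_measurable_divide lm dens_measurable f0)
    have "(\<integral>\<^sup>+y. ennreal (?d y / l y) \<partial>data_dist f0) = (\<integral>\<^sup>+y. ennreal (?d y) * ennreal (?d y / l y) \<partial>base_measure)"
      by (intro nn_integral_data_dist f0 measurable_ennreal_base m)
    also have "\<dots> \<le> (\<integral>\<^sup>+y. ennreal (?d y / (1 - \<eta>) + 4 / \<eta> * \<bar>?d y - dens g y\<bar>) \<partial>base_measure)"
    proof (rule nn_integral_mono)
      fix y assume y: "y \<in> space base_measure"
      note db = dens_bounds[OF f0 y] and gb = dens_bounds[OF g y]
      let ?e = "\<bar>?d y - dens g y\<bar>"
      have l0: "l y > 0" using lb[OF y] \<eta> by linarith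
      have "?d y * (?d y / l y) \<le> ?d y * ((dens g y + ?e) / l y)"
        using db l0 by (intro mult_left_mono divide_right_mono) auto
      also have "\<dots> = ?d y * (dens g y / l y) + ?d y * (?e / l y)"
        by (simp add: add_divide_distrib algebra_simps)
      also have "\<dots> \<le> ?d y * (1 / (1 - \<eta>)) + 1 * (?e / (\<eta> / 4))"
      proof (intro add_mono mult_mono)
        show "dens g y / l y \<le> 1 / (1 - \<eta>)"
          using lb[OF y] l0 \<eta> by (simp add: field_simps)
        show "?e / l y \<le> ?e / (\<eta> / 4)"
          using lb[OF y] \<eta> l0 by (intro divide_left_mono) auto
      qed (use db gb l0 in auto)
      finally have "?d y * (?d y / l y) \<le> ?d y / (1 - \<eta>) + 4 / \<eta> * ?e" by (simp add: mult.commute)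
      then have "ennreal (?d y * (?d y / l y)) \<le> ennreal (?d y / (1 - \<eta>) + 4 / \<eta> * ?e)"
        by (rule ennreal_leI)
      then show "ennreal (?d y) * ennreal (?d y / l y) \<le> ennreal (?d y / (1 - \<eta>) + 4 / \<eta> * ?e)"
        using db l0 by (simp only: ennreal_mult divide_nonneg_pos)
    qed
    also have "\<dots> = ennreal (\<integral>y. ?d y / (1 - \<eta>) + 4 / \<eta> * \<bar>?d y - dens g y\<bar> \<partial>base_measure)"
    proof (rule nn_integral_eq_integral)
      show "integrable base_measure (\<lambda>y. ?d y / (1 - \<eta>) + 4 / \<eta> * \<bar>?d y - dens g y\<bar>)"
        by (intro Bochner_Integration.integrable_add integrable_divide integrable_mult_right
            integrable_density integrable_sqrt_diff(3) dens_in_densities f0 g)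
      show "AE y in base_measure. 0 \<le> ?d y / (1 - \<eta>) + 4 / \<eta> * \<bar>?d y - dens g y\<bar>"
        using dens_bounds[OF f0] \<eta> by (intro AE_I2) simp
    qed
    also have "(\<integral>y. ?d y / (1 - \<eta>) + 4 / \<eta> * \<bar>?d y - dens g y\<bar> \<partial>base_measure)
        = 1 / (1 - \<eta>) + 4 / \<eta> * (\<integral>y. \<bar>?d y - dens g y\<bar> \<partial>base_measure)"
      using integrable_density[OF dens_in_densities[OF f0]]
        integrable_sqrt_diff(3)[OF dens_in_densities[OF f0] dens_in_densities[OF g]]
        integral_density[OF dens_in_densities[OF f0]]
      by simp
    also have "\<dots> = 1 / (1 - \<eta>) + 8 / \<eta> * (\<integral>x. \<bar>f0 x - g x\<bar> \<partial>unit_uniform)"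
      by (simp add: integral_abs_dens_diff[OF f0 g])
    also have "(\<integral>x. \<bar>f0 x - g x\<bar> \<partial>unit_uniform) = (\<integral>x. \<bar>f0 x - h0 x\<bar> \<partial>unit_uniform)"
      by (rule Bochner_Integration.integral_cong) (auto simp: g_def)
    also have "1 / (1 - \<eta>) + 8 / \<eta> * (\<integral>x. \<bar>f0 x - h0 x\<bar> \<partial>unit_uniform) \<le> a"
    proof -
      have "8 / \<eta> * (\<integral>x. \<bar>f0 x - h0 x\<bar> \<partial>unit_uniform) \<le> 8 / \<eta> * \<tau>"
        using h0(3) \<eta> by (intro mult_left_mono) auto
      also have "\<dots> = (a - 1) / 2" using \<eta> by (simp add: \<tau>_def)
      finally have "8 / \<eta> * (\<integral>x. \<bar>f0 x - h0 x\<bar> \<partial>unit_uniform) \<le> (a - 1) / 2" .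
      moreover have "1 / (1 - \<eta>) \<le> 1 + 2 * \<eta>"
      proof -
        have "0 \<le> \<eta> * (1 - 2 * \<eta>)" using \<eta> by (intro mult_nonneg_nonneg) auto
        then show ?thesis using \<eta> by (simp add: field_simps)
      qed
      ultimately show ?thesis using \<eta>(3) by argo
    qed
    finally show ?thesis by (simp add: ennreal_leI)
  qed
  define V where "V n z = (\<Prod>i<n. ennreal (?d (z i) / l (z i)))" for n and z :: "nat \<Rightarrow> real \<times> nat"
  have Dm: "(\<lambda>y. ennreal (?d y / l y)) \<in> borel_measurable (data_dist f0)"
    unfolding borel_data_dist
    by (intro measurable_ennreal_base borel_measurable_divide lm dens_measurable f0)
  have Vm: "V n \<in> borel_measurable ?P" for n
    unfolding V_def by (intro borel_measurable_prod_ennreal measurable_coord_comp Dm UNIV_I)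
  have Vint: "(\<integral>\<^sup>+z. V n z \<partial>?P) \<le> ennreal (1 * a ^ n)" for n
  proof -
    have "(\<integral>\<^sup>+z. V n z \<partial>?P) = (\<integral>\<^sup>+y. ennreal (?d y / l y) \<partial>data_dist f0) ^ n"
      unfolding V_def by (rule nn_integral_PiM_prod[OF prob_space_data_dist[OF f0] Dm])
    also have "\<dots> \<le> ennreal a ^ n" by (intro power_mono chi) simp
    finally show ?thesis using a by (simp add: ennreal_power)
  qed
  have "AE z in ?P. eventually (\<lambda>n. V n z \<le> ennreal (q ^ n)) sequentially"
    using a by (intro AE_eventually_le_geometric[OF Vm Vint]) auto
  define c where "c = pmf \<kappa> k * measure (params k) B"
  interpret pk: prob_space "params k" by (rule prob_space_params)
  have c: "c > 0"
    using B(2) \<kappa>pos[OF k] by (simp add: c_def pk.emeasure_eq_measure)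
  have "AE z in ?P. eventually (\<lambda>n.
       ennreal (c * (\<Prod>i<n. ?d (z i)) / q ^ n) \<le> (\<integral>\<^sup>+f. ennreal (\<Prod>i<n. f (z i)) \<partial>prior \<kappa>)) sequentially"
    using \<open>AE z in ?P. eventually (\<lambda>n. V n z \<le> ennreal (q ^ n)) sequentially\<close> AE_data_pos[OF f0]
  proof eventually_elim
    case (elim z)
    then have zs: "z i \<in> space base_measure" and d0: "0 < ?d (z i)" for i by auto
    have l0: "0 < l (z i)" for i using lb[OF zs[of i]] \<eta> by linarith
    from elim(1) show ?case
    proof eventually_elim
      case (elim n)
      let ?p = "\<lambda>f. ennreal (\<Prod>i<n. f (z i))"
      have pm: "?p \<in> borel_measurable density_algebra"
        by (intro measurable_compose[OF _ measurable_ennreal] borel_measurable_prod measurable_evaluation zs)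
      have L0: "0 < (\<Prod>i<n. l (z i))" by (intro prod_pos) (use l0 in blast)
      have "V n z = ennreal (\<Prod>i<n. ?d (z i) / l (z i))"
        unfolding V_def using d0 l0 by (intro prod_ennreal) (auto intro: less_imp_le divide_pos_pos)
      then have "ennreal ((\<Prod>i<n. ?d (z i)) / (\<Prod>i<n. l (z i))) \<le> ennreal (q ^ n)"
        using elim by (simp only: prod_dividef)
      then have "(\<Prod>i<n. ?d (z i)) / (\<Prod>i<n. l (z i)) \<le> q ^ n"
        using q by (subst (asm) ennreal_le_iff) auto
      then have dl: "(\<Prod>i<n. ?d (z i)) / q ^ n \<le> (\<Prod>i<n. l (z i))"
        using L0 q by (simp add: field_simps)
      have "c * (\<Prod>i<n. ?d (z i)) / q ^ n \<le> c * (\<Prod>i<n. l (z i))"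
        using mult_left_mono[OF dl, of c] c by simp
      then have "ennreal (c * (\<Prod>i<n. ?d (z i)) / q ^ n) \<le> ennreal (c * (\<Prod>i<n. l (z i)))"
        by (rule ennreal_leI)
      also have "\<dots> = ennreal (pmf \<kappa> k) * (ennreal (\<Prod>i<n. l (z i)) * emeasure (params k) B)"
        using L0 unfolding c_def pk.emeasure_eq_measure
        by (simp add: ennreal_mult mult_ac)
      also have "ennreal (\<Prod>i<n. l (z i)) * emeasure (params k) B
          = (\<integral>\<^sup>+w. ennreal (\<Prod>i<n. l (z i)) * indicator B w \<partial>params k)"
        using B(1) by (rule nn_integral_cmult_indicator[symmetric])
      also have "ennreal (pmf \<kappa> k) * (\<integral>\<^sup>+w. ennreal (\<Prod>i<n. l (z i)) * indicator B w \<partial>params k)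
          \<le> ennreal (pmf \<kappa> k) * (\<integral>\<^sup>+w. ?p (step_dens k w) \<partial>params k)"
      proof (intro mult_left_mono nn_integral_mono)
        fix w
        show "ennreal (\<Prod>i<n. l (z i)) * indicator B w \<le> ?p (step_dens k w)"
        proof (cases "w \<in> B")
          case True
          have "(\<Prod>i<n. l (z i)) \<le> (\<Prod>i<n. step_dens k w (z i))"
            using l_le[OF True zs] l0 by (intro prod_mono) (auto intro: less_imp_le)
          then show ?thesis using True by (simp add: ennreal_leI)
        next
          case False
          show ?thesis by (simp only: indicator_simps(2)[OF False] mult_zero_right zero_le)
        qed
      qed simp
      also have "\<dots> \<le> (\<Sum>k. ennreal (pmf \<kappa> k) * (\<integral>\<^sup>+w. ?p (step_dens k w) \<partial>params k))"
        using sum_le_suminf[of "\<lambda>k. ennreal (pmf \<kappa> k) * (\<integral>\<^sup>+w. ?p (step_dens k w) \<partial>params k)" "{k}"] by simp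
      also have "\<dots> = (\<integral>\<^sup>+f. ?p f \<partial>prior \<kappa>)"
        by (rule nn_integral_prior[OF pm, symmetric])
      finally show ?case .
    qed
  qed
  with c that show thesis by blast
qed

section \<open>Posterior consistency\<close>

lemma likelihood_bounds:
  assumes "\<forall>i. z i \<in> space base_measure" "f \<in> densities"
  shows "0 \<le> (\<Prod>i<n. f (z i))" "(\<Prod>i<n. f (z i)) \<le> 1"
  using density_bounds[OF assms(2) assms(1)[rule_format]] by (auto intro!: prod_nonneg prod_le_1)

lemma likelihood_integrable:
  assumes z: "\<forall>i. z i \<in> space base_measure" and B: "B \<in> sets density_algebra"
  shows "integrable (prior \<kappa>) (\<lambda>f. indicator B f *\<^sub>R (\<Prod>i<n. f (z i)))"
proof -
  interpret prob_space "prior \<kappa>" by (rule prob_space_prior)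
  have "(\<lambda>f. indicator B f *\<^sub>R (\<Prod>i<n. f (z i))) \<in> borel_measurable density_algebra"
    by (intro borel_measurable_scaleR borel_measurable_indicator B borel_measurable_prod
        measurable_evaluation z[rule_format])
  then have "(\<lambda>f. indicator B f *\<^sub>R (\<Prod>i<n. f (z i))) \<in> borel_measurable (prior \<kappa>)"
    by (simp only: measurable_cong_sets[OF sets_prior refl])
  moreover have "AE f in prior \<kappa>. norm (indicator B f *\<^sub>R (\<Prod>i<n. f (z i))) \<le> 1"
    using likelihood_bounds[OF z] by (intro AE_I2) (auto simp: indicator_def)
  ultimately show ?thesis by (intro integrable_const_bound)
qed

lemma likelihood_total:
  "(LINT f|prior \<kappa>. (\<Prod>i<n. f (z i))) = (LINT f:densities|prior \<kappa>. (\<Prod>i<n. f (z i)))"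
  unfolding set_lebesgue_integral_def
  by (rule Bochner_Integration.integral_cong) auto

lemma densities_sets: "densities \<in> sets density_algebra"
  using sets.top[of density_algebra] by simp

lemma likelihood_mono:
  assumes z: "\<forall>i. z i \<in> space base_measure"
    and "A \<in> sets density_algebra" "B \<in> sets density_algebra" "A \<subseteq> B"
  shows "(LINT f:A|prior \<kappa>. (\<Prod>i<n. f (z i))) \<le> (LINT f:B|prior \<kappa>. (\<Prod>i<n. f (z i)))"
  unfolding set_lebesgue_integral_def
proof (rule integral_mono)
  fix f assume "f \<in> space (prior \<kappa>)"
  then have "0 \<le> (\<Prod>i<n. f (z i))" using likelihood_bounds[OF z] by simp
  then show "indicator A f *\<^sub>R (\<Prod>i<n. f (z i)) \<le> indicator B f *\<^sub>R (\<Prod>i<n. f (z i))"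
    using assms(4) by (auto simp: indicator_def)
qed (intro likelihood_integrable z assms)+

lemma likelihood_nonneg:
  assumes z: "\<forall>i. z i \<in> space base_measure"
  shows "0 \<le> (LINT f:B|prior \<kappa>. (\<Prod>i<n. f (z i)))"
  unfolding set_lebesgue_integral_def
  using likelihood_bounds[OF z] by (intro Bochner_Integration.integral_nonneg) simp

lemma posterior_mono:
  assumes "\<forall>i. z i \<in> space base_measure"
    and "A \<in> sets density_algebra" "B \<in> sets density_algebra" "A \<subseteq> B"
  shows "posterior \<kappa> n z A \<le> posterior \<kappa> n z B"
  unfolding posterior_def likelihood_total
  by (intro divide_right_mono likelihood_mono likelihood_nonneg assms)

lemma posterior_le_1:
  assumes z: "\<forall>i. z i \<in> space base_measure" and B: "B \<in> sets density_algebra"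
  shows "posterior \<kappa> n z B \<le> 1"
proof -
  have "B \<subseteq> densities" using sets.sets_into_space[OF B] by simp
  then have "(LINT f:B|prior \<kappa>. (\<Prod>i<n. f (z i))) \<le> (LINT f:densities|prior \<kappa>. (\<Prod>i<n. f (z i)))"
    by (intro likelihood_mono z B densities_sets)
  then show ?thesis
    unfolding posterior_def likelihood_total
    using likelihood_nonneg[OF z, of \<kappa> densities n] by (auto simp: divide_le_eq_1 less_le)
qed

lemma ennreal_likelihood:
  assumes z: "\<forall>i. z i \<in> space base_measure" and B: "B \<in> sets density_algebra"
  shows "(\<integral>\<^sup>+f. indicator B f * ennreal (\<Prod>i<n. f (z i)) \<partial>prior \<kappa>)
    = ennreal (LINT f:B|prior \<kappa>. (\<Prod>i<n. f (z i)))"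
proof -
  have "(\<integral>\<^sup>+f. indicator B f * ennreal (\<Prod>i<n. f (z i)) \<partial>prior \<kappa>)
      = (\<integral>\<^sup>+f. ennreal (indicator B f *\<^sub>R (\<Prod>i<n. f (z i))) \<partial>prior \<kappa>)"
    by (intro nn_integral_cong) (simp add: indicator_def)
  also have "\<dots> = ennreal (LINT f:B|prior \<kappa>. (\<Prod>i<n. f (z i)))"
    unfolding set_lebesgue_integral_def
    using likelihood_bounds[OF z]
    by (intro nn_integral_eq_integral likelihood_integrable z B AE_I2) simp
  finally show ?thesis .
qed

text \<open>
  For a positive marginal likelihood, the posterior masses of a ball and of its complement add up to \<open>1\<close>.
\<close>

lemma posterior_far:
  assumes z: "\<forall>i. z i \<in> space base_measure" and f0: "f0 \<in> unit_funs"
    and T: "(LINT f|prior \<kappa>. (\<Prod>i<n. f (z i))) > 0"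
  shows "1 - posterior \<kappa> n z (hellinger_nbhd f0 \<epsilon>)
    = (LINT f:{f \<in> densities. hellinger (dens f0) f > \<epsilon>}|prior \<kappa>. (\<Prod>i<n. f (z i)))
      / (LINT f|prior \<kappa>. (\<Prod>i<n. f (z i)))"
proof -
  let ?H = "hellinger_nbhd f0 \<epsilon>" and ?F = "{f \<in> densities. hellinger (dens f0) f > \<epsilon>}"
  have H: "?H \<in> sets density_algebra"
    by (intro hellinger_borel_subset hellinger_nbhd_borel f0)
  have FH: "?F = space density_algebra - ?H" by (auto simp: hellinger_nbhd_def)
  then have F: "?F \<in> sets density_algebra" using sets.compl_sets[OF H] by simp
  have "(LINT f|prior \<kappa>. (\<Prod>i<n. f (z i)))
      = (LINT f|prior \<kappa>. indicator ?H f *\<^sub>R (\<Prod>i<n. f (z i)) + indicator ?F f *\<^sub>R (\<Prod>i<n. f (z i)))"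
    by (rule Bochner_Integration.integral_cong) (auto simp: indicator_def hellinger_nbhd_def)
  also have "\<dots> = (LINT f:?H|prior \<kappa>. (\<Prod>i<n. f (z i))) + (LINT f:?F|prior \<kappa>. (\<Prod>i<n. f (z i)))"
    unfolding set_lebesgue_integral_def
    by (intro Bochner_Integration.integral_add likelihood_integrable z H F)
  finally show ?thesis
    unfolding posterior_def using T by (simp add: field_simps)
qed

text \<open>
  The quotient of the two bounds is a multiple of \<open>(b * q) ^ n\<close>.
\<close>

lemma posterior_hellinger_consistent:
  fixes \<kappa> :: "nat pmf"
  assumes \<kappa>0: "pmf \<kappa> 0 = 0" and \<kappa>pos: "\<And>k. k \<ge> 1 \<Longrightarrow> pmf \<kappa> k > 0" and \<beta>: "\<beta> > 0"
    and tail: "eventually (\<lambda>j::nat. measure_pmf.prob \<kappa> {k. k \<ge> j} \<le> exp (- \<beta> * real j * ln (real j))) sequentially"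
    and f0: "f0 \<in> unit_funs" and \<epsilon>: "\<epsilon> > 0"
  shows "AE z in (\<Pi>\<^sub>M i\<in>(UNIV :: nat set). data_dist f0).
            (\<lambda>n. posterior \<kappa> n z (hellinger_nbhd f0 \<epsilon>)) \<longlonglongrightarrow> 1"
proof -
  let ?P = "\<Pi>\<^sub>M i\<in>(UNIV :: nat set). data_dist f0"
  let ?F = "{f \<in> densities. hellinger (dens f0) f > \<epsilon>}"
  obtain b :: real where b: "0 < b" "b < 1" and num: "AE z in ?P. eventually (\<lambda>n.
       (\<integral>\<^sup>+f. indicator ?F f * ennreal (\<Prod>i<n. f (z i)) \<partial>prior \<kappa>)
         \<le> ennreal (b ^ n * (\<Prod>i<n. dens f0 (z i)))) sequentially"
    using numerator_bound[OF \<kappa>0 \<beta> tail f0 \<epsilon>] by blast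
  \<comment> \<open>any number strictly between \<open>1\<close> and \<open>1 / b\<close>\<close>
  define q where "q = (1 + 1 / b) / 2"
  have q: "1 < q" "b * q < 1" "0 < b * q" using b by (auto simp: q_def field_simps intro: add_pos_pos)
  obtain c :: real where c: "c > 0" and den: "AE z in ?P. eventually (\<lambda>n.
       ennreal (c * (\<Prod>i<n. dens f0 (z i)) / q ^ n) \<le> (\<integral>\<^sup>+f. ennreal (\<Prod>i<n. f (z i)) \<partial>prior \<kappa>)) sequentially"
    using denominator_bound[OF \<kappa>pos f0 q(1)] by blast
  have F: "?F \<in> sets density_algebra"
  proof -
    have "?F = space hellinger_borel - hellinger_nbhd f0 \<epsilon>" by (auto simp: hellinger_nbhd_def)
    then show ?thesis
      using hellinger_borel_subset[OF sets.compl_sets[OF hellinger_nbhd_borel[OF f0]]] by simp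
  qed
  show ?thesis
    using num den AE_data_pos[OF f0]
  proof eventually_elim
    case (elim z)
    then have z: "\<forall>i. z i \<in> space base_measure" and d0: "\<And>i. 0 < dens f0 (z i)" by blast+
    let ?post = "\<lambda>n. posterior \<kappa> n z (hellinger_nbhd f0 \<epsilon>)"
    have "eventually (\<lambda>n. norm (1 - ?post n) \<le> (b * q) ^ n / c) sequentially"
      using elim(1,2)
    proof eventually_elim
      case (elim n)
      let ?D = "\<Prod>i<n. dens f0 (z i)" and ?T = "LINT f|prior \<kappa>. (\<Prod>i<n. f (z i))"
      let ?A = "LINT f:?F|prior \<kappa>. (\<Prod>i<n. f (z i))"
      have D: "?D > 0" by (intro prod_pos) (use d0 in blast)
      have A0: "0 \<le> ?A" by (rule likelihood_nonneg[OF z])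
      have "ennreal ?A \<le> ennreal (b ^ n * ?D)"
        using elim(1) unfolding ennreal_likelihood[OF z F] .
      then have A: "?A \<le> b ^ n * ?D"
        using b D by (subst (asm) ennreal_le_iff) auto
      have "(\<integral>\<^sup>+f. ennreal (\<Prod>i<n. f (z i)) \<partial>prior \<kappa>)
          = (\<integral>\<^sup>+f. indicator densities f * ennreal (\<Prod>i<n. f (z i)) \<partial>prior \<kappa>)"
        by (rule nn_integral_cong) simp
      also have "\<dots> = ennreal ?T"
        unfolding likelihood_total by (rule ennreal_likelihood[OF z densities_sets])
      finally have "ennreal (c * ?D / q ^ n) \<le> ennreal ?T" using elim(2) by simp
      then have T: "c * ?D / q ^ n \<le> ?T"
        using likelihood_nonneg[OF z, of \<kappa> densities n]
        by (subst (asm) ennreal_le_iff) (auto simp: likelihood_total)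
      have T1: "0 < c * ?D / q ^ n" using c D q by simp
      then have T0: "0 < ?T" using T by linarith
      have "?A / ?T \<le> (b ^ n * ?D) / (c * ?D / q ^ n)"
        using A T T1 A0 by (intro frac_le) auto
      also have "\<dots> = (b * q) ^ n / c"
      proof -
        have "(b ^ n * d) / (c * d / q ^ n) = (b * q) ^ n / c" if "d > 0" for d
          using that c by (simp add: power_mult_distrib)
        then show ?thesis using D .
      qed
      finally show ?case
        unfolding posterior_far[OF z f0 T0] using A0 T0 by simp
    qed
    moreover have "(\<lambda>n. (b * q) ^ n / c) \<longlonglongrightarrow> 0"
      using q tendsto_divide[OF LIMSEQ_power_zero[of "b * q"] tendsto_const[of c]] c by simp
    ultimately have "(\<lambda>n. 1 - ?post n) \<longlonglongrightarrow> 0"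
      by (rule Lim_null_comparison)
    from tendsto_diff[OF tendsto_const[of 1] this] show "?post \<longlonglongrightarrow> 1" by simp
  qed
qed

theorem theoremt:
  fixes \<kappa> :: "nat pmf" and \<beta> :: real and f0 :: "real \<Rightarrow> real"
  assumes "pmf \<kappa> 0 = 0"
    and "\<And>k. k \<ge> 1 \<Longrightarrow> pmf \<kappa> k > 0"
    and "\<beta> > 0"
    and "eventually (\<lambda>j::nat. measure_pmf.prob \<kappa> {k. k \<ge> j} \<le> exp (- \<beta> * real j * ln (real j)))
           sequentially"
    and "f0 \<in> unit_funs"
  shows "(\<forall>\<epsilon>>0. AE z in (\<Pi>\<^sub>M i\<in>(UNIV :: nat set). data_dist f0).
            (\<lambda>n. posterior \<kappa> n z (hellinger_nbhd f0 \<epsilon>)) \<longlonglongrightarrow> 1) \<and>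
         (\<forall>p\<ge>1. \<forall>\<epsilon>>0. AE z in (\<Pi>\<^sub>M i\<in>(UNIV :: nat set). data_dist f0).
            (\<lambda>n. posterior \<kappa> n z {dens f | f. f \<in> unit_funs \<and> lp_norm p (\<lambda>x. f x - f0 x) < \<epsilon>})
              \<longlonglongrightarrow> 1)"
proof (intro conjI allI impI)
  have consistent: "AE z in (\<Pi>\<^sub>M i\<in>(UNIV :: nat set). data_dist f0).
      (\<lambda>n. posterior \<kappa> n z (hellinger_nbhd f0 \<epsilon>)) \<longlonglongrightarrow> 1" if "\<epsilon> > 0" for \<epsilon>
    using assms that by (intro posterior_hellinger_consistent)
  fix \<epsilon> :: real assume \<epsilon>: "\<epsilon> > 0"
  show "AE z in (\<Pi>\<^sub>M i\<in>(UNIV :: nat set). data_dist f0).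
      (\<lambda>n. posterior \<kappa> n z (hellinger_nbhd f0 \<epsilon>)) \<longlonglongrightarrow> 1"
    by (rule consistent[OF \<epsilon>])
  fix p :: real assume p: "p \<ge> 1"
  let ?H = "hellinger_nbhd f0 (\<epsilon> powr p / (2 * p))"
  note f0 = assms(5)
  have H: "?H \<in> sets density_algebra" and B: "lp_ball f0 p \<epsilon> \<in> sets density_algebra"
    by (intro hellinger_borel_subset hellinger_nbhd_borel lp_ball_borel f0 p \<epsilon>)+
  have "\<epsilon> powr p / (2 * p) > 0" using p \<epsilon> by simp
  from consistent[OF this] AE_data_pos[OF f0]
  show "AE z in (\<Pi>\<^sub>M i\<in>(UNIV :: nat set). data_dist f0).
      (\<lambda>n. posterior \<kappa> n z (lp_ball f0 p \<epsilon>)) \<longlonglongrightarrow> 1"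
  proof eventually_elim
    case (elim z)
    then have z: "\<forall>i. z i \<in> space base_measure" by blast
    show ?case
    proof (rule tendsto_sandwich[OF _ _ elim(1) tendsto_const])
      show "eventually (\<lambda>n. posterior \<kappa> n z ?H \<le> posterior \<kappa> n z (lp_ball f0 p \<epsilon>)) sequentially"
        by (intro always_eventually allI posterior_mono z H B hellinger_nbhd_subset_lp_ball p f0 \<epsilon>)
      show "eventually (\<lambda>n. posterior \<kappa> n z (lp_ball f0 p \<epsilon>) \<le> 1) sequentially"
        by (intro always_eventually allI posterior_le_1 z B)
    qed
  qed
qed

end
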